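(* There exist a stationary Gaussian positively associated linear process $$X_k=\sum_{i=0}^{\infty}t_iY_{k-i},\qquad k\in\mathbb{Z},$$ where $t_i\geq 0$ are real numbers and $(Y_i)_{i\in\mathbb{Z}}$ is an i.i.d. sequence of standard normal random variables, and a non-decreasing filtration $(\mathcal{F}_k)_{k\in\mathbb{Z}}$ such that, with $S_n=X_1+\cdots+X_n$ and $\sigma_n^2=\mathrm{Var}(S_n)$: (i) $X_k$ is adapted to $\mathcal{F}_k$ (that is, $X_k$ is $\mathcal{F}_k$-measurable for every $k$); (ii) $\mathbb{E}(X_k\mid\mathcal{F}_{-\infty})=0$ a.s. for all $k$; (iii) $\displaystyle\sup_{k\geq 0}\sum_{j\in\mathbb{Z}}\|P_j(X_k)\|<\infty$; (iv) $\sigma_n^2$ is not regularly varying with index $1$; more exactly, there exist a positive constant $c$ and a subsequence $k_n\to\infty$ such that $\mathrm{Var}(S_{k_n})\geq c\,k_n^2/\ln^4(k_n)$; (v) $\sigma_n^{-1}S_{[nt]}$ does not satisfy the invariance principle, i.e. it does not converge weakly to the standard Brownian motion on $[0,1]$.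
   Context: $\mathcal{F}_{-\infty}=\bigcap_{i\in\mathbb{Z}}\mathcal{F}_i$; $P_j(X)=\mathbb{E}(X\mid\mathcal{F}_j)-\mathbb{E}(X\mid\mathcal{F}_{j-1})$; $\|X\|=\sqrt{\mathbb{E}(X^2)}$; $[x]$ is the integer part of $x$. Weak convergence in (v) is in $D[0,1]$, the space of cadlag functions on $[0,1]$, endowed with the uniform topology. A sequence is positively associated if for every finite subfamily, any two coordinatewise non-decreasing functions of that subfamily have nonnegative covariance whenever the covariance exists. A positive sequence $(v_n)$ is regularly varying with index $1$ if $v_{[\lambda n]}/v_n\to\lambda$ for every $\lambda>0$. *)

theory Defs
  imports "HOL-Probability.Probability"
begin

section \<open>Conditional expectations and the L2 norm\<close>

definition L2_norm :: "'a measure \<Rightarrow> ('a \<Rightarrow> real) \<Rightarrow> real" where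
  "L2_norm M X = sqrt (\<integral>\<omega>. (X \<omega>)\<^sup>2 \<partial>M)"

definition filtration_tail :: "'a measure \<Rightarrow> (int \<Rightarrow> 'a measure) \<Rightarrow> 'a measure" where
  "filtration_tail M F = sigma (space M) (\<Inter>i. sets (F i))"

definition proj_diff ::
  "'a measure \<Rightarrow> (int \<Rightarrow> 'a measure) \<Rightarrow> int \<Rightarrow> ('a \<Rightarrow> real) \<Rightarrow> 'a \<Rightarrow> real" where
  "proj_diff M F j X = (\<lambda>\<omega>. real_cond_exp M (F j) X \<omega> - real_cond_exp M (F (j - 1)) X \<omega>)"

section \<open>Properties of a process indexed by the integers\<close>

definition iid_std_normal :: "'a measure \<Rightarrow> ('i \<Rightarrow> 'a \<Rightarrow> real) \<Rightarrow> bool" where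
  "iid_std_normal M Y \<longleftrightarrow>
     prob_space.indep_vars M (\<lambda>_. borel) Y UNIV \<and>
     (\<forall>i. distributed M lborel (Y i) std_normal_density)"

definition strictly_stationary :: "'a measure \<Rightarrow> (int \<Rightarrow> 'a \<Rightarrow> real) \<Rightarrow> bool" where
  "strictly_stationary M X \<longleftrightarrow>
     (\<forall>h. distr M (Pi\<^sub>M UNIV (\<lambda>_. borel)) (\<lambda>\<omega> k. X (k + h) \<omega>) =
          distr M (Pi\<^sub>M UNIV (\<lambda>_. borel)) (\<lambda>\<omega> k. X k \<omega>))"

text \<open>A normal law may be degenerate; \<^const>\<open>normal_density\<close> does not cover variance zero.\<close>

definition normally_distributed :: "'a measure \<Rightarrow> ('a \<Rightarrow> real) \<Rightarrow> bool" where
  "normally_distributed M Z \<longleftrightarrow>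
     (\<exists>m. (Z \<in> borel_measurable M \<and> (AE \<omega> in M. Z \<omega> = m)) \<or>
          (\<exists>s>0. distributed M lborel Z (normal_density m s)))"

definition gaussian_process :: "'a measure \<Rightarrow> ('i \<Rightarrow> 'a \<Rightarrow> real) \<Rightarrow> bool" where
  "gaussian_process M X \<longleftrightarrow>
     (\<forall>J a. finite J \<longrightarrow> normally_distributed M (\<lambda>\<omega>. \<Sum>j\<in>J. a j * X j \<omega>))"

definition cov :: "'a measure \<Rightarrow> ('a \<Rightarrow> real) \<Rightarrow> ('a \<Rightarrow> real) \<Rightarrow> real" where
  "cov M U V = (\<integral>\<omega>. U \<omega> * V \<omega> \<partial>M) - (\<integral>\<omega>. U \<omega> \<partial>M) * (\<integral>\<omega>. V \<omega> \<partial>M)"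

text \<open>Functions on the Cartesian power of the line over a finite \<open>J\<close> are functions on the extensional
  families over \<open>J\<close>, ordered pointwise. Integrability of the compositions is what makes the
  covariance exist; it includes their measurability.\<close>

definition positively_associated :: "'a measure \<Rightarrow> ('i \<Rightarrow> 'a \<Rightarrow> real) \<Rightarrow> bool" where
  "positively_associated M X \<longleftrightarrow>
     (\<forall>J (f :: ('i \<Rightarrow> real) \<Rightarrow> real) (g :: ('i \<Rightarrow> real) \<Rightarrow> real).
        let XJ = (\<lambda>\<omega>. \<lambda>j\<in>J. X j \<omega>) in
        finite J \<longrightarrow>
        mono_on (J \<rightarrow>\<^sub>E UNIV) f \<longrightarrow> mono_on (J \<rightarrow>\<^sub>E UNIV) g \<longrightarrow>
        integrable M (\<lambda>\<omega>. f (XJ \<omega>)) \<longrightarrow> integrable M (\<lambda>\<omega>. g (XJ \<omega>)) \<longrightarrow>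
        integrable M (\<lambda>\<omega>. f (XJ \<omega>) * g (XJ \<omega>)) \<longrightarrow>
        0 \<le> cov M (\<lambda>\<omega>. f (XJ \<omega>)) (\<lambda>\<omega>. g (XJ \<omega>)))"

definition partial_sum :: "(int \<Rightarrow> 'a \<Rightarrow> real) \<Rightarrow> nat \<Rightarrow> 'a \<Rightarrow> real" where
  "partial_sum X n \<omega> = (\<Sum>k=1..n. X (int k) \<omega>)"

definition regularly_varying_1 :: "(nat \<Rightarrow> real) \<Rightarrow> bool" where
  "regularly_varying_1 v \<longleftrightarrow>
     (\<forall>r>0. (\<lambda>n. v (nat \<lfloor>r * real n\<rfloor>) / v n) \<longlonglongrightarrow> r)"

section \<open>The space \<open>D[0,1]\<close> with the uniform topology\<close>

definition D01 :: "(real \<Rightarrow> real) set" where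
  "D01 = {x \<in> extensional {0..1}.
     (\<forall>t\<in>{0..<1}. (x \<longlongrightarrow> x t) (at_right t)) \<and>
     (\<forall>t\<in>{0<..1}. \<exists>l. (x \<longlongrightarrow> l) (at_left t))}"

definition sup_dist :: "(real \<Rightarrow> real) \<Rightarrow> (real \<Rightarrow> real) \<Rightarrow> real" where
  "sup_dist x y = (if x \<in> D01 \<and> y \<in> D01 then SUP t\<in>{0..1}. \<bar>x t - y t\<bar> else 0)"

definition D01_topology :: "(real \<Rightarrow> real) topology" where
  "D01_topology = Metric_space.mtopology D01 sup_dist"

definition borel_of_topology :: "'s topology \<Rightarrow> 's measure" where
  "borel_of_topology T = sigma (topspace T) {U. openin T U}"

text \<open>The supremum defining the distance is finite because cadlag functions are bounded. The value 0
  outside \<^const>\<open>D01\<close> is irrelevant, but \<^locale>\<open>Metric_space\<close> asks for a function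
  that is nonnegative everywhere.\<close>

lemma D01_bounded:
  assumes x: "x \<in> D01"
  shows "\<exists>B. \<forall>t\<in>{0..1}. \<bar>x t\<bar> \<le> B"
proof -
  have loc: "\<exists>U B. open U \<and> t \<in> U \<and> (\<forall>s\<in>U \<inter> {0..1}. \<bar>x s\<bar> \<le> B)" if t: "t \<in> {0..1}" for t :: real
  proof -
    have R: "\<exists>b>t. \<exists>B. \<forall>s. t < s \<and> s < b \<and> s \<le> 1 \<longrightarrow> \<bar>x s\<bar> \<le> B"
    proof (cases "t < 1")
      case True
      then have "(x \<longlongrightarrow> x t) (at_right t)" using x t by (auto simp: D01_def)
      then have "eventually (\<lambda>s. dist (x s) (x t) < 1) (at_right t)"
        by (rule tendstoD) simp
      then obtain b where b: "b > t" "\<And>s. t < s \<Longrightarrow> s < b \<Longrightarrow> dist (x s) (x t) < 1"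
        by (auto simp: eventually_at_right_field)
      have "\<bar>x s\<bar> \<le> \<bar>x t\<bar> + 1" if "t < s" "s < b" for s
        using b(2)[OF that] by (simp add: dist_real_def)
      with b(1) show ?thesis by blast
    next
      case False
      then show ?thesis using t by (intro exI[of _ "t + 1"]) auto
    qed
    have L: "\<exists>a<t. \<exists>B. \<forall>s. a < s \<and> s < t \<and> 0 \<le> s \<longrightarrow> \<bar>x s\<bar> \<le> B"
    proof (cases "0 < t")
      case True
      then have "t \<in> {0<..1}" using t by simp
      then obtain l where "(x \<longlongrightarrow> l) (at_left t)" using x unfolding D01_def by blast
      then have "eventually (\<lambda>s. dist (x s) l < 1) (at_left t)"
        by (rule tendstoD) simp
      then obtain a where a: "a < t" "\<And>s. a < s \<Longrightarrow> s < t \<Longrightarrow> dist (x s) l < 1"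
        by (auto simp: eventually_at_left_field)
      have "\<bar>x s\<bar> \<le> \<bar>l\<bar> + 1" if "a < s" "s < t" for s
        using a(2)[OF that] by (simp add: dist_real_def)
      with a(1) show ?thesis by blast
    next
      case False
      then show ?thesis using t by (intro exI[of _ "t - 1"]) auto
    qed
    from R obtain b B1 where b: "b > t" "\<And>s. t < s \<Longrightarrow> s < b \<Longrightarrow> s \<le> 1 \<Longrightarrow> \<bar>x s\<bar> \<le> B1" by blast
    from L obtain a B2 where a: "a < t" "\<And>s. a < s \<Longrightarrow> s < t \<Longrightarrow> 0 \<le> s \<Longrightarrow> \<bar>x s\<bar> \<le> B2" by blast
    let ?B = "max \<bar>x t\<bar> (max B1 B2)"
    have "\<bar>x s\<bar> \<le> ?B" if "s \<in> {a<..<b} \<inter> {0..1}" for s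
    proof -
      consider "s < t" | "s = t" | "t < s" by linarith
      then show ?thesis
      proof cases
        case 1
        then have "\<bar>x s\<bar> \<le> B2" using that a(2) by auto
        then show ?thesis by linarith
      next
        case 2
        then show ?thesis by simp
      next
        case 3
        then have "\<bar>x s\<bar> \<le> B1" using that b(2) by auto
        then show ?thesis by linarith
      qed
    qed
    then show ?thesis using a(1) b(1)
      by (intro exI[of _ "{a<..<b}"] exI[of _ ?B]) auto
  qed
  then obtain U B where UB: "\<And>t. t \<in> {0..1::real} \<Longrightarrow>
      open (U t) \<and> t \<in> U t \<and> (\<forall>s\<in>U t \<inter> {0..1}. \<bar>x s\<bar> \<le> B t)"
    by metis
  have "{0..1::real} \<subseteq> (\<Union>t\<in>{0..1}. U t)" using UB by blast
  then obtain K where K: "K \<subseteq> {0..1::real}" "finite K" "{0..1} \<subseteq> (\<Union>t\<in>K. U t)"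
    using compactE_image[OF compact_Icc, of "{0..1::real}" U "0::real" "1::real"] UB by metis
  have "\<bar>x s\<bar> \<le> (\<Sum>t\<in>K. \<bar>B t\<bar>)" if s: "s \<in> {0..1}" for s
  proof -
    obtain t where t: "t \<in> K" "s \<in> U t" using K s by blast
    then have "\<bar>x s\<bar> \<le> \<bar>B t\<bar>" using UB[of t] K s by force
    also have "\<dots> \<le> (\<Sum>t\<in>K. \<bar>B t\<bar>)" using t K by (intro member_le_sum) auto
    finally show ?thesis .
  qed
  then show ?thesis by blast
qed

lemma sup_dist_bdd:
  assumes "x \<in> D01" "y \<in> D01"
  shows "bdd_above ((\<lambda>t. \<bar>x t - y t\<bar>) ` {0..1})"
proof -
  obtain A B where "\<forall>t\<in>{0..1}. \<bar>x t\<bar> \<le> A" "\<forall>t\<in>{0..1}. \<bar>y t\<bar> \<le> B"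
    using assms D01_bounded by meson
  then show ?thesis by (intro bdd_aboveI2[where M = "A + B"]) force
qed

lemma sup_dist_upper:
  assumes "x \<in> D01" "y \<in> D01" "t \<in> {0..1}"
  shows "\<bar>x t - y t\<bar> \<le> sup_dist x y"
  using assms cSUP_upper[OF assms(3) sup_dist_bdd[OF assms(1,2)]] by (simp add: sup_dist_def)

lemma Metric_space_D01: "Metric_space D01 sup_dist"
proof
  fix x y z
  show "0 \<le> sup_dist x y"
  proof (cases "x \<in> D01 \<and> y \<in> D01")
    case True
    then have "\<bar>x 0 - y 0\<bar> \<le> sup_dist x y" by (intro sup_dist_upper) auto
    then show ?thesis by linarith
  next
    case False
    then show ?thesis by (auto simp: sup_dist_def)
  qed
  show "sup_dist x y = sup_dist y x"
    by (simp add: sup_dist_def abs_minus_commute)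
  assume xy: "x \<in> D01" "y \<in> D01"
  show "sup_dist x y = 0 \<longleftrightarrow> x = y"
  proof
    assume "sup_dist x y = 0"
    then have "x t = y t" if "t \<in> {0..1}" for t
      using sup_dist_upper[OF xy that] by simp
    then show "x = y"
      using xy by (intro extensionalityI[of _ "{0..1}"]) (auto simp: D01_def)
  qed (simp add: sup_dist_def)
  assume z: "z \<in> D01"
  have "(SUP t\<in>{0..1}. \<bar>x t - z t\<bar>) \<le> sup_dist x y + sup_dist y z"
  proof (rule cSUP_least)
    fix t :: real assume "t \<in> {0..1}"
    then show "\<bar>x t - z t\<bar> \<le> sup_dist x y + sup_dist y z"
      using sup_dist_upper[OF xy, of t] sup_dist_upper[OF xy(2) z, of t] by linarith
  qed simp
  then show "sup_dist x z \<le> sup_dist x y + sup_dist y z"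
    using xy z by (simp add: sup_dist_def)
qed

section \<open>Brownian motion and weak convergence\<close>

definition std_brownian_motion :: "'b measure \<Rightarrow> (real \<Rightarrow> 'b \<Rightarrow> real) \<Rightarrow> bool" where
  "std_brownian_motion N W \<longleftrightarrow>
     prob_space N \<and>
     (\<forall>t\<in>{0..1}. W t \<in> borel_measurable N) \<and>
     (AE \<omega> in N. W 0 \<omega> = 0) \<and>
     (AE \<omega> in N. continuous_on {0..1} (\<lambda>t. W t \<omega>)) \<and>
     (\<forall>s t. 0 \<le> s \<longrightarrow> s < t \<longrightarrow> t \<le> 1 \<longrightarrow>
        distributed N lborel (\<lambda>\<omega>. W t \<omega> - W s \<omega>) (normal_density 0 (sqrt (t - s)))) \<and>
     (\<forall>(n::nat) \<tau>. strict_mono_on {..n} \<tau> \<longrightarrow> \<tau> ` {..n} \<subseteq> {0..1} \<longrightarrow>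
        prob_space.indep_vars N (\<lambda>_. borel) (\<lambda>i \<omega>. W (\<tau> (Suc i)) \<omega> - W (\<tau> i) \<omega>) {..<n})"

text \<open>The law of standard Brownian motion on \<open>D[0,1]\<close>: the Borel probability measure under which the
  coordinate process is a standard Brownian motion.\<close>

definition wiener_measure :: "(real \<Rightarrow> real) measure \<Rightarrow> bool" where
  "wiener_measure \<mu> \<longleftrightarrow>
     space \<mu> = D01 \<and> sets \<mu> = sets (borel_of_topology D01_topology) \<and>
     std_brownian_motion \<mu> (\<lambda>t x. x t)"

definition converges_weakly ::
  "'s topology \<Rightarrow> 'a measure \<Rightarrow> (nat \<Rightarrow> 'a \<Rightarrow> 's) \<Rightarrow> 's measure \<Rightarrow> bool" where
  "converges_weakly T M Z \<mu> \<longleftrightarrow>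
     (\<forall>f. continuous_map T euclideanreal f \<longrightarrow> bounded (f ` topspace T) \<longrightarrow>
        (\<lambda>n. \<integral>\<omega>. f (Z n \<omega>) \<partial>M) \<longlonglongrightarrow> (\<integral>x. f x \<partial>\<mu>))"

definition normalized_path :: "'a measure \<Rightarrow> (int \<Rightarrow> 'a \<Rightarrow> real) \<Rightarrow> nat \<Rightarrow> 'a \<Rightarrow> real \<Rightarrow> real" where
  "normalized_path M X n \<omega> =
     (\<lambda>t\<in>{0..1}. partial_sum X (nat \<lfloor>real n * t\<rfloor>) \<omega> /
                  sqrt (prob_space.variance M (partial_sum X n)))"

lemma normalized_path_in_D01: "normalized_path M X n \<omega> \<in> D01"
proof -
  define g where "g = (\<lambda>i::int. partial_sum X (nat i) \<omega> / sqrt (prob_space.variance M (partial_sum X n)))"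
  have eq: "normalized_path M X n \<omega> = (\<lambda>t\<in>{0..1}. g \<lfloor>real n * t\<rfloor>)"
    by (simp add: normalized_path_def g_def)
  have R: "\<forall>\<^sub>F s in at_right t. g \<lfloor>real n * s\<rfloor> = g \<lfloor>real n * t\<rfloor>" for t
  proof (cases "n = 0")
    case False
    let ?b = "(of_int \<lfloor>real n * t\<rfloor> + 1) / real n"
    have b: "t < ?b" using False floor_correct[of "real n * t"] by (simp add: pos_less_divide_eq mult.commute)
    have "\<lfloor>real n * s\<rfloor> = \<lfloor>real n * t\<rfloor>" if "t < s" "s < ?b" for s
    proof -
      have "real n * s < of_int \<lfloor>real n * t\<rfloor> + 1" using that False by (simp add: pos_less_divide_eq mult.commute)
      moreover have "real n * t \<le> real n * s" using that by (simp add: mult_left_mono)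
      ultimately show ?thesis by linarith
    qed
    then show ?thesis using b unfolding eventually_at_right_field by (intro exI[of _ ?b]) simp
  qed simp
  have L: "\<forall>\<^sub>F s in at_left t. g \<lfloor>real n * s\<rfloor> = g (if n = 0 then 0 else \<lceil>real n * t\<rceil> - 1)" for t
  proof (cases "n = 0")
    case False
    let ?a = "(of_int \<lceil>real n * t\<rceil> - 1) / real n"
    have a: "?a < t" using False ceiling_correct[of "real n * t"] by (simp add: pos_divide_less_eq mult.commute)
    have "\<lfloor>real n * s\<rfloor> = \<lceil>real n * t\<rceil> - 1" if "?a < s" "s < t" for s
    proof -
      have "of_int \<lceil>real n * t\<rceil> - 1 < real n * s" using that False by (simp add: pos_divide_less_eq mult.commute)
      moreover have "real n * s < real n * t" using that False by simp
      ultimately show ?thesis by linarith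
    qed
    then show ?thesis using a False unfolding eventually_at_left_field by (intro exI[of _ ?a]) simp
  qed simp
  have "(normalized_path M X n \<omega> \<longlongrightarrow> normalized_path M X n \<omega> t) (at_right t)"
    if t: "t \<in> {0..<1}" for t
  proof (rule tendsto_eventually)
    have "\<forall>\<^sub>F s in at_right t. s < 1"
      using t unfolding eventually_at_right_field by auto
    with R[of t] eventually_at_right_less[of t]
    show "\<forall>\<^sub>F s in at_right t. normalized_path M X n \<omega> s = normalized_path M X n \<omega> t"
      by eventually_elim (use t in \<open>auto simp: eq\<close>)
  qed
  moreover have "\<exists>l. (normalized_path M X n \<omega> \<longlongrightarrow> l) (at_left t)" if t: "t \<in> {0<..1}" for t
  proof (intro exI tendsto_eventually)
    have "\<forall>\<^sub>F s in at_left t. 0 < s \<and> s < t"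
      using t unfolding eventually_at_left_field by auto
    with L[of t]
    show "\<forall>\<^sub>F s in at_left t. normalized_path M X n \<omega> s = g (if n = 0 then 0 else \<lceil>real n * t\<rceil> - 1)"
      by eventually_elim (use t in \<open>auto simp: eq\<close>)
  qed
  ultimately show ?thesis by (simp add: D01_def normalized_path_def)
qed

end

theory Submission
  imports Defs
begin

text \<open>
  With the filtration generated by the innovations \<open>Y\<^sub>i\<close>, \<open>i \<le> k\<close>, condition (iii) says that \<open>\<Sum> t\<^sub>i\<close> is
  finite, and then the variance of \<open>S\<^sub>n\<close> grows at most linearly. The idea is to use another filtration, one
  for which (i)-(iii) hold for every square summable sequence \<open>t\<close>. Choose \<open>a\<^sub>0 < a\<^sub>1 < \<dots>\<close> so sparse
  that the tail of \<open>\<Sum> t\<^sub>i\<^sup>2\<close> from \<open>a\<^sub>l\<close> on is at most \<open>4\<^sup>-\<^sup>l\<close>. Let \<open>F\<^sub>j\<close> be generated by the \<open>Y\<^sub>i\<close> with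
  \<open>i \<le> - a\<^sub>l\<close> when \<open>- a\<^sub>l\<^sub>+\<^sub>1 < j \<le> - a\<^sub>l\<close>, and by all the \<open>Y\<^sub>i\<close> when \<open>j > - a\<^sub>0\<close>. Then \<open>F\<^sub>j\<close> contains the
  past of \<open>j\<close>, so the process is adapted. The filtration jumps only at \<open>j = 1 - a\<^sub>l\<close>, and what it
  learns there for \<open>l \<ge> 1\<close> enters \<open>X\<^sub>k\<close>, \<open>k \<ge> 0\<close>, through coefficients of index at least \<open>a\<^sub>l\<^sub>-\<^sub>1\<close>. The norms of the
  projections are therefore dominated by a geometric series, uniformly in \<open>k \<ge> 0\<close>
  (\<open>summable_projections\<close>), and \<open>E(X\<^sub>k | F\<^sub>j)\<close> tends to \<open>0\<close> as \<open>j\<close> tends to \<open>-\<infinity>\<close>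
  (\<open>cond_exp_remote_past\<close>).

  This leaves \<open>t\<close> free, and \<open>t\<^sub>i = 1 / (sqrt (i + 2) ln\<^sup>2 (i + 2))\<close> is square summable but far from
  summable. Each of the \<open>n\<close> innovations \<open>Y\<^sub>m\<close> with \<open>- n < m \<le> 0\<close> enters \<open>S\<^sub>n\<close> with a weight of at least
  \<open>n t\<^sub>2\<^sub>n\<close>, so the variance \<open>v\<^sub>n\<close> of \<open>S\<^sub>n\<close> is at least \<open>n\<^sup>3 t\<^sub>2\<^sub>n\<^sup>2\<close>, which is of order \<open>n\<^sup>2 / ln\<^sup>4 n\<close>.
  Regular variation with index 1 would make the ratio of \<open>v\<close> at \<open>2\<^sup>m\<close> and \<open>2\<^sup>m\<^sup>+\<^sup>1\<close> tend to \<open>1/2\<close>, so that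
  \<open>v\<close> at \<open>2\<^sup>m\<close> would be \<open>O(3\<^sup>m)\<close>, against the lower bound of order \<open>4\<^sup>m / m\<^sup>4\<close>
  (\<open>dyadic_ratio_not_half\<close>). The invariance principle would force the same limit of the ratio: the
  bounded continuous function \<open>x \<mapsto> cos (x (1/2))\<close> has expectation \<open>exp (- v\<^sub>n / (2 v\<^sub>2\<^sub>n))\<close> along the
  normalized paths of even index \<open>2n\<close>, and \<open>exp (- 1/4)\<close> under Wiener measure
  (\<open>weak_limit_variance_ratio\<close>).

  The almost sure convergence of the series is Kolmogorov's theorem. For positive association, every
  \<open>X\<^sub>k\<close> is a nondecreasing function of the independent \<open>Y\<^sub>i\<close>; the inequality of Harris for infinitely
  many independent coordinates applies to arbitrary monotone functions of the process, since only
  the measurability of the compositions enters (\<open>harris_inequality\<close>).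
\<close>

section \<open>Association of monotone functions on a product space\<close>

text \<open>Since \<open>(f x - f y) (g x - g y) \<ge> 0\<close>, integrating in \<open>y\<close> and then in \<open>x\<close> gives twice the covariance.\<close>

lemma chebyshev_association:
  fixes f g :: "'a::linorder \<Rightarrow> real"
  assumes "prob_space M" "mono f" "mono g"
    and f: "integrable M f" and g: "integrable M g" and fg: "integrable M (\<lambda>x. f x * g x)"
  shows "integral\<^sup>L M f * integral\<^sup>L M g \<le> (\<integral>x. f x * g x \<partial>M)"
proof -
  interpret prob_space M by fact
  let ?E = expectation
  have pt: "0 \<le> f x * g x - f x * ?E g - g x * ?E f + ?E (\<lambda>y. f y * g y)" for x
  proof -
    have "0 \<le> ?E (\<lambda>y. (f x - f y) * (g x - g y))"
    proof (intro Bochner_Integration.integral_nonneg)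
      fix y show "0 \<le> (f x - f y) * (g x - g y)"
        using linear[of x y] \<open>mono f\<close> \<open>mono g\<close>
        by (auto simp: mono_def zero_le_mult_iff)
    qed
    also have "?E (\<lambda>y. (f x - f y) * (g x - g y)) = ?E (\<lambda>y. (f x * g x - f x * g y) - (g x * f y - f y * g y))"
      by (intro Bochner_Integration.integral_cong) (auto simp: algebra_simps)
    also have "\<dots> = f x * g x - f x * ?E g - g x * ?E f + ?E (\<lambda>y. f y * g y)"
      using f g fg by (simp add: prob_space)
    finally show ?thesis .
  qed
  have "0 \<le> ?E (\<lambda>x. f x * g x - f x * ?E g - g x * ?E f + ?E (\<lambda>y. f y * g y))"
    using pt by (rule Bochner_Integration.integral_nonneg)
  also have "\<dots> = 2 * (?E (\<lambda>x. f x * g x) - ?E f * ?E g)"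
    using f g fg by (simp add: prob_space)
  finally show ?thesis by simp
qed

definition bounded_measurable :: "'a measure \<Rightarrow> ('a \<Rightarrow> real) \<Rightarrow> bool" where
  "bounded_measurable M h \<longleftrightarrow> h \<in> borel_measurable M \<and> (\<exists>B. \<forall>x. \<bar>h x\<bar> \<le> B)"

lemma (in finite_measure) bounded_measurable_integrable:
  "bounded_measurable M h \<Longrightarrow> integrable M h"
  unfolding bounded_measurable_def using integrable_const_bound[of h] by auto

lemma bounded_measurable_abs: "bounded_measurable M h \<Longrightarrow> bounded_measurable M (\<lambda>x. \<bar>h x\<bar>)"
  unfolding bounded_measurable_def by auto

lemma bounded_measurable_mult:
  assumes "bounded_measurable M f" "bounded_measurable M g"
  shows "bounded_measurable M (\<lambda>x. f x * g x)"
proof -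
  obtain A B where "\<And>x. \<bar>f x\<bar> \<le> A" "\<And>x. \<bar>g x\<bar> \<le> B"
    using assms unfolding bounded_measurable_def by blast
  then have "\<bar>f x * g x\<bar> \<le> A * B" for x
    unfolding abs_mult by (intro mult_mono) (auto intro: order_trans[OF abs_ge_zero])
  then show ?thesis using assms unfolding bounded_measurable_def by auto
qed

lemma bounded_measurable_lin:
  assumes "bounded_measurable M f" "bounded_measurable M g"
  shows "bounded_measurable M (\<lambda>x. a * f x + b * g x)"
proof -
  obtain A B where AB: "\<And>x. \<bar>f x\<bar> \<le> A" "\<And>x. \<bar>g x\<bar> \<le> B"
    using assms unfolding bounded_measurable_def by blast
  have "\<bar>a * f x + b * g x\<bar> \<le> \<bar>a\<bar> * A + \<bar>b\<bar> * B" for x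
    using mult_left_mono[OF AB(1)[of x], of "\<bar>a\<bar>"] mult_left_mono[OF AB(2)[of x], of "\<bar>b\<bar>"]
    by (simp add: abs_mult[symmetric])
  then show ?thesis using assms unfolding bounded_measurable_def by auto
qed

definition depends_only_on :: "'i set \<Rightarrow> (('i \<Rightarrow> 'b) \<Rightarrow> 'c) \<Rightarrow> bool" where
  "depends_only_on K h \<longleftrightarrow> (\<forall>\<xi> \<xi>'. (\<forall>i\<in>K. \<xi> i = \<xi>' i) \<longrightarrow> h \<xi> = h \<xi>')"

text \<open>The conditional expectation of \<open>h\<close> given all coordinates but \<open>m\<close>, in a version that is defined at
  every point. Working with this version keeps monotonicity exact instead of almost sure.\<close>

definition resample :: "('i \<Rightarrow> 'b measure) \<Rightarrow> 'i \<Rightarrow> (('i \<Rightarrow> 'b) \<Rightarrow> real) \<Rightarrow> ('i \<Rightarrow> 'b) \<Rightarrow> real" where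
  "resample N m h \<xi> = (\<integral>y. h (\<xi>(m := y)) \<partial>N m)"

text \<open>The Harris inequality is proved by averaging coordinates out one after the other. Averaging preserves
  monotonicity and, by the one-dimensional inequality, can only decrease the expectation of a product
  of two monotone functions. When enough coordinates are averaged out, each factor is close in \<open>L\<^sup>1\<close> to
  its expectation, because cylinder functions are dense.\<close>

locale full_product_prob_space = product_prob_space N "UNIV :: 'i set" for N :: "'i \<Rightarrow> real measure" +
  assumes sets_N [measurable_cong]: "\<And>i. sets (N i) = sets borel"
begin

abbreviation "P \<equiv> PiM (UNIV :: 'i set) N"

lemma space_factor [simp]: "space (N i) = UNIV"
  using sets_eq_imp_space_eq[OF sets_N] by simp

lemma space_product [simp]: "space P = UNIV"
  by (simp add: space_PiM)

lemma prob_space_factor: "prob_space (N i)"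
  by (rule M.prob_space_axioms)

lemma measurable_upd [measurable]: "(\<lambda>(y, \<xi>). \<xi>(m := y)) \<in> measurable (N m \<Otimes>\<^sub>M P) P"
  unfolding split_beta' by (rule measurable_fun_upd[where J = UNIV]) auto

text \<open>Replacing one coordinate by an independent copy preserves the product measure.\<close>

lemma distr_upd: "distr (N m \<Otimes>\<^sub>M P) P (\<lambda>(y, \<xi>). \<xi>(m := y)) = P"
  using distr_pair_PiM_eq_PiM[of UNIV N m] prob_space_factor by simp

lemma measurable_upd_pair:
  "h \<in> borel_measurable P \<Longrightarrow> (\<lambda>(\<xi>, y). h (\<xi>(m := y))) \<in> borel_measurable (P \<Otimes>\<^sub>M N m)"
proof -
  assume h: "h \<in> borel_measurable P"
  have "(\<lambda>(\<xi>, y). \<xi>(m := y)) \<in> measurable (P \<Otimes>\<^sub>M N m) P"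
    unfolding split_beta' by (rule measurable_fun_upd[where J = UNIV]) auto
  from measurable_compose[OF this h] show ?thesis by (simp add: split_beta')
qed

lemma measurable_upd_section:
  "h \<in> borel_measurable P \<Longrightarrow> (\<lambda>y. h (\<xi>(m := y))) \<in> borel_measurable (N m)"
  using measurable_compose[OF measurable_Pair1'[of \<xi> P "N m"] measurable_upd_pair[of h m]] by simp

lemma bounded_measurable_section:
  assumes "bounded_measurable P h"
  shows "bounded_measurable (N m) (\<lambda>y. h (\<xi>(m := y)))"
  using assms unfolding bounded_measurable_def by (auto intro: measurable_upd_section)

lemma abs_resample_le:
  assumes h: "h \<in> borel_measurable P" and B: "\<And>\<xi>. \<bar>h \<xi>\<bar> \<le> B"
  shows "\<bar>resample N m h \<xi>\<bar> \<le> B"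
proof -
  have bm: "bounded_measurable P h" using h B unfolding bounded_measurable_def by blast
  have "\<bar>resample N m h \<xi>\<bar> \<le> (\<integral>y. \<bar>h (\<xi>(m := y))\<bar> \<partial>N m)"
    unfolding resample_def by (rule integral_abs_bound)
  also have "\<dots> \<le> (\<integral>y. B \<partial>N m)"
    using bm B
    by (intro integral_mono M.bounded_measurable_integrable bounded_measurable_abs bounded_measurable_section)
      (auto simp: bounded_measurable_def)
  finally show ?thesis using M.prob_space[of m] by simp
qed

lemma bounded_measurable_resample:
  assumes h: "bounded_measurable P h"
  shows "bounded_measurable P (resample N m h)"
proof -
  obtain B where B: "\<And>x. \<bar>h x\<bar> \<le> B" and hm: "h \<in> borel_measurable P"
    using h unfolding bounded_measurable_def by blast
  have "resample N m h \<in> borel_measurable P"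
    unfolding resample_def[abs_def]
    by (rule M.borel_measurable_lebesgue_integral) (rule measurable_upd_pair[OF hm])
  then show ?thesis using abs_resample_le[OF hm B] unfolding bounded_measurable_def by blast
qed

lemma integral_resample:
  assumes h: "bounded_measurable P h"
  shows "(\<integral>\<xi>. resample N m h \<xi> \<partial>P) = (\<integral>\<xi>. h \<xi> \<partial>P)"
proof -
  interpret pp: pair_prob_space "N m" P ..
  have [measurable]: "h \<in> borel_measurable P" using h unfolding bounded_measurable_def by blast
  obtain B where B: "\<And>x. \<bar>h x\<bar> \<le> B" using h unfolding bounded_measurable_def by blast
  have "(\<integral>\<xi>. h \<xi> \<partial>P) = (\<integral>x. h ((\<lambda>(y, \<xi>). \<xi>(m := y)) x) \<partial>(N m \<Otimes>\<^sub>M P))"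
    by (subst distr_upd[of m, symmetric], subst integral_distr) auto
  also have "\<dots> = (\<integral>x. (\<lambda>(y, \<xi>). h (\<xi>(m := y))) x \<partial>(N m \<Otimes>\<^sub>M P))"
    by (simp add: split_beta')
  also have "\<dots> = (\<integral>\<xi>. (\<integral>y. h (\<xi>(m := y)) \<partial>N m) \<partial>P)"
    using B by (intro pp.integral_snd[symmetric] pp.P.integrable_const_bound[where B = B]) (auto simp: split_beta')
  finally show ?thesis by (simp add: resample_def)
qed

lemma resample_lin:
  assumes "bounded_measurable P f" "bounded_measurable P g"
  shows "resample N m (\<lambda>\<xi>. a * f \<xi> + b * g \<xi>) \<xi> = a * resample N m f \<xi> + b * resample N m g \<xi>"
proof -
  have "integrable (N m) (\<lambda>y. f (\<xi>(m := y)))" "integrable (N m) (\<lambda>y. g (\<xi>(m := y)))"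
    using assms by (auto intro!: M.bounded_measurable_integrable bounded_measurable_section)
  then show ?thesis unfolding resample_def by simp
qed

lemma resample_contraction:
  assumes h: "bounded_measurable P h"
  shows "(\<integral>\<xi>. \<bar>resample N m h \<xi>\<bar> \<partial>P) \<le> (\<integral>\<xi>. \<bar>h \<xi>\<bar> \<partial>P)"
proof -
  have h': "bounded_measurable P (\<lambda>\<xi>. \<bar>h \<xi>\<bar>)" using h unfolding bounded_measurable_def by auto
  have "(\<integral>\<xi>. \<bar>resample N m h \<xi>\<bar> \<partial>P) \<le> (\<integral>\<xi>. resample N m (\<lambda>\<xi>. \<bar>h \<xi>\<bar>) \<xi> \<partial>P)"
  proof (intro integral_mono)
    show "integrable P (\<lambda>\<xi>. \<bar>resample N m h \<xi>\<bar>)" "integrable P (resample N m (\<lambda>\<xi>. \<bar>h \<xi>\<bar>))"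
      using h h' by (auto intro!: bounded_measurable_integrable bounded_measurable_resample bounded_measurable_abs)
    show "\<bar>resample N m h \<xi>\<bar> \<le> resample N m (\<lambda>\<xi>. \<bar>h \<xi>\<bar>) \<xi>" for \<xi>
      unfolding resample_def using integral_norm_bound[of "N m" "\<lambda>y. h (\<xi>(m := y))"] by simp
  qed
  then show ?thesis using integral_resample[OF h'] by simp
qed

lemma depends_only_on_resample:
  assumes "depends_only_on K h"
  shows "depends_only_on (K - {m}) (resample N m h)"
  unfolding depends_only_on_def
proof (intro allI impI)
  fix \<xi> \<xi>' :: "'i \<Rightarrow> real" assume "\<forall>i\<in>K - {m}. \<xi> i = \<xi>' i"
  then have "\<forall>i\<in>K. (\<xi>(m := y)) i = (\<xi>'(m := y)) i" for y by simp
  then have "h (\<xi>(m := y)) = h (\<xi>'(m := y))" for y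
    using assms unfolding depends_only_on_def by blast
  then show "resample N m h \<xi> = resample N m h \<xi>'" by (simp add: resample_def)
qed

definition resample_list :: "'i list \<Rightarrow> (('i \<Rightarrow> real) \<Rightarrow> real) \<Rightarrow> ('i \<Rightarrow> real) \<Rightarrow> real" where
  "resample_list ms h = fold (resample N) ms h"

lemma resample_list_simps [simp]:
  "resample_list [] h = h"
  "resample_list (m # ms) h = resample_list ms (resample N m h)"
  by (simp_all add: resample_list_def)

lemma bounded_measurable_resample_list:
  "bounded_measurable P h \<Longrightarrow> bounded_measurable P (resample_list ms h)"
  by (induction ms arbitrary: h) (auto intro: bounded_measurable_resample)

lemma abs_resample_list_le:
  assumes "h \<in> borel_measurable P" "\<And>\<xi>. \<bar>h \<xi>\<bar> \<le> B"
  shows "\<bar>resample_list ms h \<xi>\<bar> \<le> B"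
  using assms
proof (induction ms arbitrary: h)
  case (Cons m ms)
  have "bounded_measurable P h" using Cons.prems unfolding bounded_measurable_def by blast
  then have "resample N m h \<in> borel_measurable P"
    using bounded_measurable_resample unfolding bounded_measurable_def by blast
  then show ?case using Cons.IH abs_resample_le[OF Cons.prems] by simp
qed simp

lemma integral_resample_list:
  "bounded_measurable P h \<Longrightarrow> (\<integral>\<xi>. resample_list ms h \<xi> \<partial>P) = (\<integral>\<xi>. h \<xi> \<partial>P)"
  by (induction ms arbitrary: h) (auto simp: bounded_measurable_resample integral_resample)

lemma resample_list_diff:
  "bounded_measurable P f \<Longrightarrow> bounded_measurable P g \<Longrightarrow>
    resample_list ms (\<lambda>\<xi>. f \<xi> - g \<xi>) = (\<lambda>\<xi>. resample_list ms f \<xi> - resample_list ms g \<xi>)"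
proof (induction ms arbitrary: f g)
  case (Cons m ms)
  have "resample N m (\<lambda>\<xi>. f \<xi> - g \<xi>) = (\<lambda>\<xi>. resample N m f \<xi> - resample N m g \<xi>)"
    using resample_lin[OF Cons.prems, of m 1 "-1"] by (simp add: fun_eq_iff)
  then show ?case using Cons by (simp add: bounded_measurable_resample)
qed simp

lemma resample_list_contraction:
  "bounded_measurable P h \<Longrightarrow> (\<integral>\<xi>. \<bar>resample_list ms h \<xi>\<bar> \<partial>P) \<le> (\<integral>\<xi>. \<bar>h \<xi>\<bar> \<partial>P)"
  by (induction ms arbitrary: h)
     (auto intro: order_trans[OF _ resample_contraction] bounded_measurable_resample)

text \<open>Each averaging step removes one coordinate from those that the function depends on, so what remains
  is constant; and averaging preserves the expectation.\<close>

lemma resample_list_cylinder: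
  assumes g: "bounded_measurable P g" and "depends_only_on (set ms) g"
  shows "resample_list ms g = (\<lambda>_. \<integral>\<xi>. g \<xi> \<partial>P)"
proof -
  have "depends_only_on (K - set ms) (resample_list ms h)" if "depends_only_on K h" for K h
    using that
  proof (induction ms arbitrary: K h)
    case (Cons m ms)
    from Cons.IH[OF depends_only_on_resample[OF Cons.prems, of m]]
    show ?case by (metis Diff_insert2 list.simps(15) resample_list_simps(2))
  qed simp
  from this[OF assms(2)] have "resample_list ms g \<xi> = resample_list ms g undefined" for \<xi>
    unfolding depends_only_on_def by auto
  then have c: "resample_list ms g = (\<lambda>_. resample_list ms g undefined)" by (simp add: fun_eq_iff)
  have "(\<integral>\<xi>. g \<xi> \<partial>P) = (\<integral>\<xi>. resample_list ms g \<xi> \<partial>P)" using integral_resample_list[OF g] by simp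
  also have "\<dots> = resample_list ms g undefined" by (subst c) (simp add: P.prob_space[simplified])
  finally show ?thesis using c by simp
qed

definition cylinder_approximable :: "(('i \<Rightarrow> real) \<Rightarrow> real) \<Rightarrow> bool" where
  "cylinder_approximable f \<longleftrightarrow> (\<forall>e>0. \<exists>g K. finite K \<and> depends_only_on K g \<and> bounded_measurable P g \<and>
      (\<integral>\<xi>. \<bar>f \<xi> - g \<xi>\<bar> \<partial>P) < e)"

lemma cylinder_approximable_closed:
  assumes f: "integrable P f"
    and lim: "\<And>e. e > 0 \<Longrightarrow> \<exists>f'. integrable P f' \<and> cylinder_approximable f' \<and> (\<integral>\<xi>. \<bar>f \<xi> - f' \<xi>\<bar> \<partial>P) < e"
  shows "cylinder_approximable f"
  unfolding cylinder_approximable_def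
proof (intro allI impI)
  fix e :: real assume "e > 0"
  then obtain f' where f': "integrable P f'" "cylinder_approximable f'" "(\<integral>\<xi>. \<bar>f \<xi> - f' \<xi>\<bar> \<partial>P) < e / 2"
    using lim[OF half_gt_zero[OF \<open>e > 0\<close>]] by blast
  obtain g K where g: "finite K" "depends_only_on K g" "bounded_measurable P g" "(\<integral>\<xi>. \<bar>f' \<xi> - g \<xi>\<bar> \<partial>P) < e / 2"
    using f'(2)[unfolded cylinder_approximable_def, rule_format, OF half_gt_zero[OF \<open>e > 0\<close>]] by blast
  have gi: "integrable P g" using g(3) by (rule bounded_measurable_integrable)
  have "(\<integral>\<xi>. \<bar>f \<xi> - g \<xi>\<bar> \<partial>P) \<le> (\<integral>\<xi>. \<bar>f \<xi> - f' \<xi>\<bar> + \<bar>f' \<xi> - g \<xi>\<bar> \<partial>P)"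
  proof (rule integral_mono)
    show "integrable P (\<lambda>\<xi>. \<bar>f \<xi> - g \<xi>\<bar>)"
      by (intro integrable_abs Bochner_Integration.integrable_diff f gi)
    show "integrable P (\<lambda>\<xi>. \<bar>f \<xi> - f' \<xi>\<bar> + \<bar>f' \<xi> - g \<xi>\<bar>)"
      by (intro Bochner_Integration.integrable_add integrable_abs Bochner_Integration.integrable_diff f f'(1) gi)
  qed linarith
  also have "\<dots> = (\<integral>\<xi>. \<bar>f \<xi> - f' \<xi>\<bar> \<partial>P) + (\<integral>\<xi>. \<bar>f' \<xi> - g \<xi>\<bar> \<partial>P)"
    by (intro Bochner_Integration.integral_add integrable_abs Bochner_Integration.integrable_diff f f'(1) gi)
  also have "\<dots> < e" using f'(3) g(4) by simp
  finally show "\<exists>g K. finite K \<and> depends_only_on K g \<and> bounded_measurable P g \<and> (\<integral>\<xi>. \<bar>f \<xi> - g \<xi>\<bar> \<partial>P) < e"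
    using g(1-3) by (intro exI[of _ g] exI[of _ K] conjI)
qed

lemma cylinder_approximable_lin:
  assumes f: "integrable P f1" "integrable P f2"
    and Q: "cylinder_approximable f1" "cylinder_approximable f2"
  shows "cylinder_approximable (\<lambda>\<xi>. a * f1 \<xi> + b * f2 \<xi>)"
  unfolding cylinder_approximable_def
proof (intro allI impI)
  fix e :: real assume "e > 0"
  define d where "d = e / (\<bar>a\<bar> + \<bar>b\<bar> + 1)"
  have d: "d > 0" using \<open>e > 0\<close> by (auto simp: d_def intro!: divide_pos_pos)
  obtain g1 K1 where g1: "finite K1" "depends_only_on K1 g1" "bounded_measurable P g1" "(\<integral>\<xi>. \<bar>f1 \<xi> - g1 \<xi>\<bar> \<partial>P) < d"
    using Q(1) d unfolding cylinder_approximable_def by blast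
  obtain g2 K2 where g2: "finite K2" "depends_only_on K2 g2" "bounded_measurable P g2" "(\<integral>\<xi>. \<bar>f2 \<xi> - g2 \<xi>\<bar> \<partial>P) < d"
    using Q(2) d unfolding cylinder_approximable_def by blast
  have gi: "integrable P g1" "integrable P g2" using g1(3) g2(3) by (auto intro: bounded_measurable_integrable)
  have "(\<integral>\<xi>. \<bar>a * f1 \<xi> + b * f2 \<xi> - (a * g1 \<xi> + b * g2 \<xi>)\<bar> \<partial>P)
      \<le> (\<integral>\<xi>. \<bar>a\<bar> * \<bar>f1 \<xi> - g1 \<xi>\<bar> + \<bar>b\<bar> * \<bar>f2 \<xi> - g2 \<xi>\<bar> \<partial>P)"
  proof (intro integral_mono)
    fix \<xi>
    have "a * f1 \<xi> + b * f2 \<xi> - (a * g1 \<xi> + b * g2 \<xi>) = a * (f1 \<xi> - g1 \<xi>) + b * (f2 \<xi> - g2 \<xi>)"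
      by (simp add: algebra_simps)
    then show "\<bar>a * f1 \<xi> + b * f2 \<xi> - (a * g1 \<xi> + b * g2 \<xi>)\<bar> \<le> \<bar>a\<bar> * \<bar>f1 \<xi> - g1 \<xi>\<bar> + \<bar>b\<bar> * \<bar>f2 \<xi> - g2 \<xi>\<bar>"
      by (metis abs_mult abs_triangle_ineq)
  qed (use f gi in auto)
  also have "\<dots> = \<bar>a\<bar> * (\<integral>\<xi>. \<bar>f1 \<xi> - g1 \<xi>\<bar> \<partial>P) + \<bar>b\<bar> * (\<integral>\<xi>. \<bar>f2 \<xi> - g2 \<xi>\<bar> \<partial>P)"
    using f gi by simp
  also have "\<dots> \<le> \<bar>a\<bar> * d + \<bar>b\<bar> * d"
    using g1(4) g2(4) by (intro add_mono mult_left_mono) auto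
  also have "\<dots> < (\<bar>a\<bar> + \<bar>b\<bar> + 1) * d" using d by (simp add: algebra_simps)
  also have "\<dots> = e" by (simp add: d_def add_nonneg_eq_0_iff)
  finally have *: "(\<integral>\<xi>. \<bar>a * f1 \<xi> + b * f2 \<xi> - (a * g1 \<xi> + b * g2 \<xi>)\<bar> \<partial>P) < e" .
  have "depends_only_on (K1 \<union> K2) (\<lambda>\<xi>. a * g1 \<xi> + b * g2 \<xi>)"
    using g1(2) g2(2) unfolding depends_only_on_def by (metis UnCI)
  then show "\<exists>g K. finite K \<and> depends_only_on K g \<and> bounded_measurable P g \<and>
      (\<integral>\<xi>. \<bar>a * f1 \<xi> + b * f2 \<xi> - g \<xi>\<bar> \<partial>P) < e"
    using * g1 g2 by (intro exI[of _ "\<lambda>\<xi>. a * g1 \<xi> + b * g2 \<xi>"] exI[of _ "K1 \<union> K2"])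
      (auto intro: bounded_measurable_lin)
qed

text \<open>Dynkin's argument: cylinder sets form an intersection-stable generator, and approximability passes to
  complements and to countable disjoint unions.\<close>

lemma cylinder_approximable_indicator:
  assumes "A \<in> sets P"
  shows "cylinder_approximable (indicator A)"
proof -
  have "A \<in> sigma_sets (\<Pi>\<^sub>E i\<in>UNIV. space (N i)) (prod_algebra UNIV N)"
    using assms by (simp add: sets_PiM)
  with Int_stable_prod_algebra[of UNIV N] prod_algebra_sets_into_space[of UNIV N]
  show ?thesis
  proof (induction rule: sigma_sets_induct_disjoint)
    case (basic A)
    then obtain J E where A: "A = prod_emb UNIV N J (Pi\<^sub>E J E)" "finite J" "\<And>i. i \<in> J \<Longrightarrow> E i \<in> sets (N i)"
      by (auto elim!: prod_algebraE)
    have "A \<in> sets P" unfolding A(1) using A(2,3) by (intro sets_PiM_I) auto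
    then have "bounded_measurable P (indicator A)"
      unfolding bounded_measurable_def by (auto intro!: exI[of _ 1] simp: indicator_def)
    moreover have "depends_only_on J (indicator A :: _ \<Rightarrow> real)"
      unfolding depends_only_on_def A(1) prod_emb_def
      by (auto simp: indicator_def PiE_iff)
    ultimately show ?case unfolding cylinder_approximable_def
      using A(2) by (auto intro!: exI[of _ "indicator A"] exI[of _ J])
  next
    case empty
    have "bounded_measurable P (\<lambda>_. 0)" "depends_only_on {} (\<lambda>_::'i \<Rightarrow> real. 0 :: real)"
      by (auto simp: bounded_measurable_def depends_only_on_def)
    then show ?case unfolding cylinder_approximable_def
      by (intro allI impI exI[of _ "\<lambda>_. 0"] exI[of _ "{}"]) auto
  next
    case (compl A)
    then have [measurable]: "A \<in> sets P" by (simp add: sets_PiM)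
    have "bounded_measurable P (\<lambda>_. 1)" "depends_only_on {} (\<lambda>_::'i \<Rightarrow> real. 1 :: real)"
      by (auto simp: bounded_measurable_def depends_only_on_def)
    then have "cylinder_approximable (\<lambda>_. 1)" unfolding cylinder_approximable_def
      by (intro allI impI exI[of _ "\<lambda>_. 1"] exI[of _ "{}"]) auto
    then have "cylinder_approximable (\<lambda>\<xi>. 1 * 1 + (- 1) * indicator A \<xi>)"
      using compl by (intro cylinder_approximable_lin) (auto simp: emeasure_eq_measure)
    also have "(\<lambda>\<xi>. 1 * 1 + (- 1) * indicator A \<xi>) = (indicator ((\<Pi>\<^sub>E i\<in>UNIV. space (N i)) - A) :: _ \<Rightarrow> real)"
      by (auto simp: indicator_def fun_eq_iff)
    finally show ?case .
  next
    case (union A)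
    then have [measurable]: "A i \<in> sets P" for i by (auto simp: sets_PiM)
    have fin: "cylinder_approximable (indicator (\<Union>i<n. A i))" for n
    proof (induction n)
      case 0
      have "bounded_measurable P (\<lambda>_. 0)" "depends_only_on {} (\<lambda>_::'i \<Rightarrow> real. 0 :: real)"
        by (auto simp: bounded_measurable_def depends_only_on_def)
      then show ?case unfolding cylinder_approximable_def
        by (intro allI impI exI[of _ "\<lambda>_. 0"] exI[of _ "{}"]) auto
    next
      case (Suc n)
      have "cylinder_approximable (\<lambda>\<xi>. 1 * indicator (\<Union>i<n. A i) \<xi> + 1 * indicator (A n) \<xi>)"
        using Suc union(3) by (intro cylinder_approximable_lin) (auto simp: emeasure_eq_measure)
      also have "(\<lambda>\<xi>. 1 * indicator (\<Union>i<n. A i) \<xi> + 1 * indicator (A n) \<xi>) = (indicator (\<Union>i<Suc n. A i) :: _ \<Rightarrow> real)"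
      proof
        fix \<xi>
        have "A i \<inter> A n = {}" if "i < n" for i
          using union(1) that unfolding disjoint_family_on_def by auto
        then have "\<xi> \<in> A n \<longrightarrow> \<not> (\<exists>i\<in>{..<n}. \<xi> \<in> A i)" by blast
        then show "1 * indicator (\<Union>i<n. A i) \<xi> + 1 * indicator (A n) \<xi> = (indicator (\<Union>i<Suc n. A i) \<xi> :: real)"
          by (auto simp: indicator_def lessThan_Suc)
      qed
      finally show ?case .
    qed
    show ?case
    proof (rule cylinder_approximable_closed)
      fix e :: real assume e: "e > 0"
      have "(\<lambda>n. measure P (\<Union>i<n. A i)) \<longlonglongrightarrow> measure P (\<Union>n. \<Union>i<n. A i)"
        by (intro finite_Lim_measure_incseq incseq_SucI) (auto simp: lessThan_Suc)
      also have "(\<Union>n. \<Union>i<n. A i) = (\<Union>i. A i)" by auto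
      finally have "\<forall>\<^sub>F n in sequentially. dist (measure P (\<Union>i<n. A i)) (measure P (\<Union>i. A i)) < e"
        using e by (rule tendstoD)
      then obtain n where n: "dist (measure P (\<Union>i<n. A i)) (measure P (\<Union>i. A i)) < e"
        by (auto simp: eventually_sequentially)
      have "(\<integral>\<xi>. \<bar>indicator (\<Union>i. A i) \<xi> - indicator (\<Union>i<n. A i) \<xi> :: real\<bar> \<partial>P)
          = (\<integral>\<xi>. indicator (\<Union>i. A i) \<xi> - indicator (\<Union>i<n. A i) \<xi> \<partial>P)"
        by (intro Bochner_Integration.integral_cong) (auto simp: indicator_def)
      also have "\<dots> = measure P (\<Union>i. A i) - measure P (\<Union>i<n. A i)"
        by (subst Bochner_Integration.integral_diff) (auto simp: emeasure_eq_measure)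
      also have "\<dots> < e" using n by (auto simp: dist_real_def)
      finally show "\<exists>f'. integrable P f' \<and> cylinder_approximable f' \<and>
          (\<integral>\<xi>. \<bar>indicator (\<Union>i. A i) \<xi> - f' \<xi>\<bar> \<partial>P) < e"
        using fin[of n] by (intro exI[of _ "indicator (\<Union>i<n. A i)"]) (auto simp: emeasure_eq_measure)
    qed (auto simp: emeasure_eq_measure)
  qed
qed

lemma cylinder_approximable_integrable:
  assumes "integrable P f"
  shows "cylinder_approximable f"
  using assms
proof (induction rule: integrable_induct)
  case (base A c)
  have "cylinder_approximable (\<lambda>\<xi>. c * indicator A \<xi> + 0 * indicator A \<xi>)"
    using base by (intro cylinder_approximable_lin cylinder_approximable_indicator) (auto simp: emeasure_eq_measure)
  then show ?case by (simp add: mult.commute)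
next
  case (add f g)
  then show ?case using cylinder_approximable_lin[of f g 1 1] by simp
next
  case (lim f s)
  show ?case
  proof (rule cylinder_approximable_closed)
    fix e :: real assume e: "e > 0"
    have "(\<lambda>n. \<integral>\<xi>. \<bar>f \<xi> - s n \<xi>\<bar> \<partial>P) \<longlonglongrightarrow> (\<integral>\<xi>. 0 \<partial>P)"
    proof (rule integral_dominated_convergence[where w = "\<lambda>\<xi>. 3 * \<bar>f \<xi>\<bar>"])
      show "AE \<xi> in P. (\<lambda>n. \<bar>f \<xi> - s n \<xi>\<bar>) \<longlonglongrightarrow> 0"
      proof (rule AE_I2)
        fix \<xi> assume "\<xi> \<in> space P"
        from tendsto_rabs[OF tendsto_diff[OF tendsto_const lim(2)[OF this], of "f \<xi>"]]
        show "(\<lambda>n. \<bar>f \<xi> - s n \<xi>\<bar>) \<longlonglongrightarrow> 0" by simp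
      qed
      show "AE \<xi> in P. norm \<bar>f \<xi> - s n \<xi>\<bar> \<le> 3 * \<bar>f \<xi>\<bar>" for n
      proof (rule AE_I2)
        fix \<xi> assume "\<xi> \<in> space P"
        then show "norm \<bar>f \<xi> - s n \<xi>\<bar> \<le> 3 * \<bar>f \<xi>\<bar>" using lim(3)[of \<xi> n] by simp
      qed
    qed (use lim in auto)
    then have "\<forall>\<^sub>F n in sequentially. (\<integral>\<xi>. \<bar>f \<xi> - s n \<xi>\<bar> \<partial>P) < e"
      using e by (simp add: order_tendstoD(2))
    then obtain n where "(\<integral>\<xi>. \<bar>f \<xi> - s n \<xi>\<bar> \<partial>P) < e" by (auto simp: eventually_sequentially)
    then show "\<exists>f'. integrable P f' \<and> cylinder_approximable f' \<and> (\<integral>\<xi>. \<bar>f \<xi> - f' \<xi>\<bar> \<partial>P) < e"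
      using lim by blast
  qed (use lim in auto)
qed

lemma mono_on_resample:
  assumes h: "bounded_measurable P h" "mono_on \<Omega> h" and \<Omega>: "\<And>\<xi> y. \<xi> \<in> \<Omega> \<Longrightarrow> \<xi>(m := y) \<in> \<Omega>"
  shows "mono_on \<Omega> (resample N m h)"
proof (rule mono_onI)
  fix \<xi> \<xi>' assume "\<xi> \<in> \<Omega>" "\<xi>' \<in> \<Omega>" "\<xi> \<le> \<xi>'"
  then have "h (\<xi>(m := y)) \<le> h (\<xi>'(m := y))" for y
    by (intro mono_onD[OF h(2)] \<Omega>) (auto simp: le_fun_def)
  then show "resample N m h \<xi> \<le> resample N m h \<xi>'"
    unfolding resample_def using h(1)
    by (intro integral_mono M.bounded_measurable_integrable bounded_measurable_section)
qed

lemma resample_mult_le: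
  assumes h1: "bounded_measurable P h1" "mono_on \<Omega> h1" and h2: "bounded_measurable P h2" "mono_on \<Omega> h2"
    and \<Omega>: "\<And>\<xi> y. \<xi> \<in> \<Omega> \<Longrightarrow> \<xi>(m := y) \<in> \<Omega>" and "\<xi> \<in> \<Omega>"
  shows "resample N m h1 \<xi> * resample N m h2 \<xi> \<le> resample N m (\<lambda>\<xi>. h1 \<xi> * h2 \<xi>) \<xi>"
proof -
  have "mono (\<lambda>y. h (\<xi>(m := y)))" if "mono_on \<Omega> h" for h :: "('i \<Rightarrow> real) \<Rightarrow> real"
    by (intro monoI mono_onD[OF that] \<Omega> \<open>\<xi> \<in> \<Omega>\<close>) (auto simp: le_fun_def)
  then show ?thesis
    unfolding resample_def using h1 h2
    by (intro chebyshev_association[OF prob_space_factor] M.bounded_measurable_integrable bounded_measurable_section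
        bounded_measurable_section[OF bounded_measurable_mult]) auto
qed

text \<open>The set \<open>\<Omega>\<close> allows for functions that are monotone only on an event of full measure, such as the event
  that a random series converges. It has to be stable under changing a single coordinate, since
  otherwise the averaged functions could lose their monotonicity.\<close>

lemma resample_list_mult_le:
  assumes "bounded_measurable P h1" "mono_on \<Omega> h1" "bounded_measurable P h2" "mono_on \<Omega> h2"
    and \<Omega>: "\<And>\<xi> m y. \<xi> \<in> \<Omega> \<Longrightarrow> \<xi>(m := y) \<in> \<Omega>" and ae: "AE \<xi> in P. \<xi> \<in> \<Omega>"
  shows "(\<integral>\<xi>. resample_list ms h1 \<xi> * resample_list ms h2 \<xi> \<partial>P) \<le> (\<integral>\<xi>. h1 \<xi> * h2 \<xi> \<partial>P)"
  using assms(1-4)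
proof (induction ms arbitrary: h1 h2)
  case (Cons m ms)
  have "(\<integral>\<xi>. resample_list (m # ms) h1 \<xi> * resample_list (m # ms) h2 \<xi> \<partial>P)
      \<le> (\<integral>\<xi>. resample N m h1 \<xi> * resample N m h2 \<xi> \<partial>P)"
    using Cons.prems \<Omega> Cons.IH[of "resample N m h1" "resample N m h2"]
    by (simp add: bounded_measurable_resample mono_on_resample)
  also have "\<dots> \<le> (\<integral>\<xi>. resample N m (\<lambda>\<xi>. h1 \<xi> * h2 \<xi>) \<xi> \<partial>P)"
  proof (rule integral_mono_AE)
    show "AE \<xi> in P. resample N m h1 \<xi> * resample N m h2 \<xi> \<le> resample N m (\<lambda>\<xi>. h1 \<xi> * h2 \<xi>) \<xi>"
      using ae by eventually_elim (use resample_mult_le[OF Cons.prems \<Omega>] in auto)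
  qed (use Cons.prems in \<open>auto intro!: bounded_measurable_integrable bounded_measurable_resample bounded_measurable_mult\<close>)
  also have "\<dots> = (\<integral>\<xi>. h1 \<xi> * h2 \<xi> \<partial>P)"
    using Cons.prems by (intro integral_resample bounded_measurable_mult)
  finally show ?case .
qed simp

proposition harris_inequality_bounded:
  assumes h1: "bounded_measurable P h1" "mono_on \<Omega> h1" and h2: "bounded_measurable P h2" "mono_on \<Omega> h2"
    and \<Omega>: "\<And>\<xi> m y. \<xi> \<in> \<Omega> \<Longrightarrow> \<xi>(m := y) \<in> \<Omega>" and ae: "AE \<xi> in P. \<xi> \<in> \<Omega>"
  shows "expectation h1 * expectation h2 \<le> expectation (\<lambda>\<xi>. h1 \<xi> * h2 \<xi>)"
proof -
  obtain B where B: "\<And>x. \<bar>h2 x\<bar> \<le> B" using h2 unfolding bounded_measurable_def by blast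
  have "expectation h1 * expectation h2 \<le> expectation (\<lambda>\<xi>. h1 \<xi> * h2 \<xi>) + e" if e: "e > 0" for e
  proof -
    \<comment> \<open>Two errors of size \<open>d\<close> occur below, each multiplied by a function that \<open>B\<close> bounds.\<close>
    define d where "d = e / (2 * (\<bar>B\<bar> + 1))"
    have d: "d > 0" using e by (auto simp: d_def)
    obtain g K where g: "finite K" "depends_only_on K g" "bounded_measurable P g" "(\<integral>\<xi>. \<bar>h1 \<xi> - g \<xi>\<bar> \<partial>P) < d"
      using cylinder_approximable_integrable[OF bounded_measurable_integrable[OF h1(1)]] d
      unfolding cylinder_approximable_def by blast
    obtain ms where ms: "set ms = K" using finite_list[OF g(1)] by blast
    let ?T = "resample_list ms"
    let ?E = "expectation"
    have bT: "bounded_measurable P (?T h1)" "bounded_measurable P (?T h2)" "bounded_measurable P (?T g)"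
      using h1 h2 g by (auto intro: bounded_measurable_resample_list)
    note int = bT[THEN bounded_measurable_integrable]
    have hg: "bounded_measurable P (\<lambda>\<xi>. h1 \<xi> - g \<xi>)"
      using bounded_measurable_lin[OF h1(1) g(3), of 1 "-1"] by simp
    have Tg: "?T g = (\<lambda>_. ?E g)" using g ms by (intro resample_list_cylinder) auto
    \<comment> \<open>Averaging turns the cylinder function \<open>g\<close> into a constant and contracts the distance to it.\<close>
    have "?E (\<lambda>\<xi>. \<bar>?T h1 \<xi> - ?E g\<bar>) = ?E (\<lambda>\<xi>. \<bar>?T (\<lambda>\<xi>. h1 \<xi> - g \<xi>) \<xi>\<bar>)"
      using resample_list_diff[OF h1(1) g(3), of ms] Tg by simp
    also have "\<dots> \<le> ?E (\<lambda>\<xi>. \<bar>h1 \<xi> - g \<xi>\<bar>)" using hg by (rule resample_list_contraction)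
    finally have 1: "?E (\<lambda>\<xi>. \<bar>?T h1 \<xi> - ?E g\<bar>) < d" using g(4) by simp
    have 2: "\<bar>?E h1 - ?E g\<bar> < d"
    proof -
      have "\<bar>?E h1 - ?E g\<bar> = \<bar>?E (\<lambda>\<xi>. h1 \<xi> - g \<xi>)\<bar>"
        using h1 g by (simp add: bounded_measurable_integrable)
      also have "\<dots> \<le> ?E (\<lambda>\<xi>. \<bar>h1 \<xi> - g \<xi>\<bar>)" by (rule integral_abs_bound)
      finally show ?thesis using g(4) by simp
    qed
    have T2B: "\<bar>?T h2 \<xi>\<bar> \<le> \<bar>B\<bar>" for \<xi>
      using h2(1) order_trans[OF B abs_ge_self]
      by (intro abs_resample_list_le) (auto simp: bounded_measurable_def)
    have "?E h1 * ?E h2 - ?E (\<lambda>\<xi>. ?T h1 \<xi> * ?T h2 \<xi>) = ?E (\<lambda>\<xi>. (?E h1 - ?T h1 \<xi>) * ?T h2 \<xi>)"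
    proof -
      have "?E (\<lambda>\<xi>. (?E h1 - ?T h1 \<xi>) * ?T h2 \<xi>) = ?E (\<lambda>\<xi>. ?E h1 * ?T h2 \<xi> - ?T h1 \<xi> * ?T h2 \<xi>)"
        by (simp add: algebra_simps)
      also have "\<dots> = ?E h1 * ?E (?T h2) - ?E (\<lambda>\<xi>. ?T h1 \<xi> * ?T h2 \<xi>)"
        using int bT by (subst Bochner_Integration.integral_diff)
          (auto intro!: bounded_measurable_integrable bounded_measurable_mult)
      finally show ?thesis using integral_resample_list[OF h2(1)] by simp
    qed
    also have "\<dots> \<le> ?E (\<lambda>\<xi>. (\<bar>?E h1 - ?E g\<bar> + \<bar>?T h1 \<xi> - ?E g\<bar>) * \<bar>B\<bar>)"
    proof (intro integral_mono)
      have const: "bounded_measurable P (\<lambda>_. 1)" by (auto simp: bounded_measurable_def)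
      have "bounded_measurable P (\<lambda>\<xi>. ?E h1 - ?T h1 \<xi>)"
        using bounded_measurable_lin[OF const bT(1), of "?E h1" "-1"] by simp
      then show "integrable P (\<lambda>\<xi>. (?E h1 - ?T h1 \<xi>) * ?T h2 \<xi>)"
        using bT(2) by (intro bounded_measurable_integrable bounded_measurable_mult)
      show "integrable P (\<lambda>\<xi>. (\<bar>?E h1 - ?E g\<bar> + \<bar>?T h1 \<xi> - ?E g\<bar>) * \<bar>B\<bar>)" using int by simp
      fix \<xi>
      have "(?E h1 - ?T h1 \<xi>) * ?T h2 \<xi> \<le> \<bar>?E h1 - ?T h1 \<xi>\<bar> * \<bar>?T h2 \<xi>\<bar>"
        by (metis abs_ge_self abs_mult)
      also have "\<dots> \<le> (\<bar>?E h1 - ?E g\<bar> + \<bar>?T h1 \<xi> - ?E g\<bar>) * \<bar>B\<bar>"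
        using T2B by (intro mult_mono) auto
      finally show "(?E h1 - ?T h1 \<xi>) * ?T h2 \<xi> \<le> (\<bar>?E h1 - ?E g\<bar> + \<bar>?T h1 \<xi> - ?E g\<bar>) * \<bar>B\<bar>" .
    qed
    also have "\<dots> = (\<bar>?E h1 - ?E g\<bar> + ?E (\<lambda>\<xi>. \<bar>?T h1 \<xi> - ?E g\<bar>)) * \<bar>B\<bar>"
      using int by (simp add: P.prob_space[simplified])
    also have "\<dots> \<le> (d + d) * \<bar>B\<bar>" using 1 2 by (intro mult_right_mono) auto
    also have "\<dots> \<le> (d + d) * (\<bar>B\<bar> + 1)" using d by (intro mult_left_mono) auto
    also have "\<dots> = e"
    proof -
      have "e / D * D = e" if "D \<noteq> 0" for D using that by simp
      moreover have "2 * (\<bar>B\<bar> + 1) \<noteq> 0" by (simp add: add_nonneg_eq_0_iff)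
      ultimately have "d * (2 * (\<bar>B\<bar> + 1)) = e" unfolding d_def by blast
      then show ?thesis by (simp add: algebra_simps)
    qed
    finally show ?thesis
      using resample_list_mult_le[OF h1 h2 \<Omega> ae, of ms] by simp
  qed
  then show ?thesis by (rule field_le_epsilon)
qed

text \<open>Truncation at the levels \<open>\<plusminus> n\<close> preserves monotonicity and reduces to the bounded case; the truncated
  product is dominated by the product itself.\<close>

theorem harris_inequality:
  fixes f g :: "('i \<Rightarrow> real) \<Rightarrow> real"
  assumes f: "integrable P f" "mono_on \<Omega> f" and g: "integrable P g" "mono_on \<Omega> g"
    and fg: "integrable P (\<lambda>\<xi>. f \<xi> * g \<xi>)"
    and \<Omega>: "\<And>\<xi> m y. \<xi> \<in> \<Omega> \<Longrightarrow> \<xi>(m := y) \<in> \<Omega>" and ae: "AE \<xi> in P. \<xi> \<in> \<Omega>"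
  shows "expectation f * expectation g \<le> expectation (\<lambda>\<xi>. f \<xi> * g \<xi>)"
proof -
  define trunc where "trunc n x = max (- real n) (min (real n) x)" for n and x :: real
  have trunc_le: "\<bar>trunc n x\<bar> \<le> \<bar>x\<bar>" for n x by (auto simp: trunc_def)
  have trunc_lim: "(\<lambda>n. trunc n x) \<longlonglongrightarrow> x" for x
  proof (rule tendsto_eventually)
    show "\<forall>\<^sub>F n in sequentially. trunc n x = x"
      using eventually_ge_at_top[of "nat \<lceil>\<bar>x\<bar>\<rceil>"]
    proof eventually_elim
      case (elim n)
      then have "\<bar>x\<bar> \<le> real n" by linarith
      then show ?case by (auto simp: trunc_def)
    qed
  qed
  have bm: "bounded_measurable P (\<lambda>\<xi>. trunc n (h \<xi>))" if "integrable P h" for n h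
    using that unfolding bounded_measurable_def trunc_def by (auto intro!: exI[of _ "real n"])
  have mo: "mono_on \<Omega> (\<lambda>\<xi>. trunc n (h \<xi>))" if "mono_on \<Omega> h" for n and h :: "('i \<Rightarrow> real) \<Rightarrow> real"
    unfolding trunc_def by (intro mono_onI max.mono min.mono mono_onD[OF that] order_refl)
  have lim1: "(\<lambda>n. expectation (\<lambda>\<xi>. trunc n (h \<xi>))) \<longlonglongrightarrow> expectation h" if h: "integrable P h" for h
    using h bm[OF h, THEN bounded_measurable_integrable] trunc_lim trunc_le
    by (intro integral_dominated_convergence[where w = "\<lambda>\<xi>. \<bar>h \<xi>\<bar>"]) auto
  have lim2: "(\<lambda>n. expectation (\<lambda>\<xi>. trunc n (f \<xi>) * trunc n (g \<xi>))) \<longlonglongrightarrow> expectation (\<lambda>\<xi>. f \<xi> * g \<xi>)"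
  proof (rule integral_dominated_convergence[where w = "\<lambda>\<xi>. \<bar>f \<xi> * g \<xi>\<bar>"])
    show "(\<lambda>\<xi>. trunc n (f \<xi>) * trunc n (g \<xi>)) \<in> borel_measurable P" for n
      using f g unfolding trunc_def by measurable
    show "AE \<xi> in P. (\<lambda>n. trunc n (f \<xi>) * trunc n (g \<xi>)) \<longlonglongrightarrow> f \<xi> * g \<xi>"
      by (intro AE_I2 tendsto_mult trunc_lim)
    show "AE \<xi> in P. norm (trunc n (f \<xi>) * trunc n (g \<xi>)) \<le> \<bar>f \<xi> * g \<xi>\<bar>" for n
      using trunc_le by (auto intro!: AE_I2 mult_mono simp: abs_mult)
  qed (use fg in auto)
  show ?thesis
  proof (rule LIMSEQ_le[OF tendsto_mult[OF lim1 lim1] lim2])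
    show "\<exists>N. \<forall>n\<ge>N. expectation (\<lambda>\<xi>. trunc n (f \<xi>)) * expectation (\<lambda>\<xi>. trunc n (g \<xi>))
        \<le> expectation (\<lambda>\<xi>. trunc n (f \<xi>) * trunc n (g \<xi>))"
      using harris_inequality_bounded[OF bm mo bm mo \<Omega> ae] f g by blast
  qed (use f g in auto)
qed

end

section \<open>Almost sure convergence of random series\<close>

context prob_space begin

lemma indep_blocks:
  fixes X :: "nat \<Rightarrow> 'a \<Rightarrow> real"
  assumes X: "indep_vars (\<lambda>_. borel) X UNIV" and "A \<inter> B = {}"
    and f: "f \<in> borel_measurable (PiM A (\<lambda>_. borel))" and g: "g \<in> borel_measurable (PiM B (\<lambda>_. borel))"
  shows "indep_var borel (\<lambda>\<omega>. f (\<lambda>i\<in>A. X i \<omega>)) borel (\<lambda>\<omega>. g (\<lambda>i\<in>B. X i \<omega>))"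
  using indep_var_compose[OF indep_var_restrict[OF X \<open>A \<inter> B = {}\<close>] f g] by (simp add: comp_def)

lemma square_integrable_sum:
  fixes X :: "'i \<Rightarrow> 'a \<Rightarrow> real"
  assumes "\<And>i. i \<in> I \<Longrightarrow> X i \<in> borel_measurable M" "\<And>i. i \<in> I \<Longrightarrow> integrable M (\<lambda>\<omega>. (X i \<omega>)\<^sup>2)"
  shows "integrable M (\<lambda>\<omega>. (\<Sum>i\<in>I. X i \<omega>)\<^sup>2)"
  using assms
proof (induction I rule: infinite_finite_induct)
  case (insert j I)
  have "integrable M (\<lambda>\<omega>. 2 * (X j \<omega>)\<^sup>2 + 2 * (\<Sum>i\<in>I. X i \<omega>)\<^sup>2)"
    using insert by auto
  then have "integrable M (\<lambda>\<omega>. (X j \<omega> + (\<Sum>i\<in>I. X i \<omega>))\<^sup>2)"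
  proof (rule Bochner_Integration.integrable_bound)
    show "(\<lambda>\<omega>. (X j \<omega> + (\<Sum>i\<in>I. X i \<omega>))\<^sup>2) \<in> borel_measurable M" using insert by auto
    have "(a + b)\<^sup>2 \<le> 2 * a\<^sup>2 + 2 * b\<^sup>2" for a b :: real
      using zero_le_power2[of "a - b"] by (simp add: power2_sum power2_diff)
    then show "AE \<omega> in M. norm ((X j \<omega> + (\<Sum>i\<in>I. X i \<omega>))\<^sup>2) \<le> norm (2 * (X j \<omega>)\<^sup>2 + 2 * (\<Sum>i\<in>I. X i \<omega>)\<^sup>2)"
      by (intro AE_I2) (simp add: order_trans)
  qed
  then show ?case using insert by simp
qed auto

lemma product_integrable_of_squares:
  fixes f g :: "'a \<Rightarrow> real"
  assumes [measurable]: "f \<in> borel_measurable M" "g \<in> borel_measurable M"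
    and "integrable M (\<lambda>\<omega>. (f \<omega>)\<^sup>2)" "integrable M (\<lambda>\<omega>. (g \<omega>)\<^sup>2)"
  shows "integrable M (\<lambda>\<omega>. f \<omega> * g \<omega>)"
proof (rule Bochner_Integration.integrable_bound)
  show "integrable M (\<lambda>\<omega>. (f \<omega>)\<^sup>2 + (g \<omega>)\<^sup>2)" using assms by auto
  have "\<bar>a * b\<bar> \<le> a\<^sup>2 + b\<^sup>2" for a b :: real
  proof -
    have "2 * (\<bar>a\<bar> * \<bar>b\<bar>) \<le> a\<^sup>2 + b\<^sup>2"
      using zero_le_power2[of "\<bar>a\<bar> - \<bar>b\<bar>"] by (simp add: power2_diff)
    moreover have "0 \<le> \<bar>a\<bar> * \<bar>b\<bar>" by simp
    ultimately show ?thesis unfolding abs_mult by linarith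
  qed
  then show "AE \<omega> in M. norm (f \<omega> * g \<omega>) \<le> norm ((f \<omega>)\<^sup>2 + (g \<omega>)\<^sup>2)" by (intro AE_I2) auto
qed measurable

lemma second_moment_sum:
  fixes X :: "nat \<Rightarrow> 'a \<Rightarrow> real"
  assumes X: "indep_vars (\<lambda>_. borel) X UNIV"
    and mean: "\<And>i. expectation (X i) = 0" and sq: "\<And>i. integrable M (\<lambda>\<omega>. (X i \<omega>)\<^sup>2)"
  shows "expectation (\<lambda>\<omega>. (\<Sum>i\<in>{m..<n}. X i \<omega>)\<^sup>2) = (\<Sum>i\<in>{m..<n}. expectation (\<lambda>\<omega>. (X i \<omega>)\<^sup>2))"
proof (induction n)
  case (Suc n)
  show ?case
  proof (cases "m \<le> n")
    case True
    let ?S = "\<lambda>\<omega>. \<Sum>i\<in>{m..<n}. X i \<omega>"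
    have [measurable]: "X i \<in> borel_measurable M" for i using X by (auto simp: indep_vars_def)
    have Xi: "integrable M (X i)" for i by (rule square_integrable_imp_integrable) (auto simp: sq)
    have S2: "integrable M (\<lambda>\<omega>. (?S \<omega>)\<^sup>2)" by (rule square_integrable_sum) (auto simp: sq)
    have S1: "integrable M ?S" using Xi by auto
    have "indep_var borel ?S borel (X n)"
      using indep_blocks[OF X, of "{m..<n}" "{n}" "\<lambda>x. \<Sum>i\<in>{m..<n}. x i" "\<lambda>x. x n"] by simp
    then have "expectation (\<lambda>\<omega>. ?S \<omega> * X n \<omega>) = 0"
      using indep_var_lebesgue_integral[OF _ S1 Xi] mean by simp
    moreover have "integrable M (\<lambda>\<omega>. ?S \<omega> * X n \<omega>)"
      by (rule product_integrable_of_squares) (auto simp: S2 sq)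
    moreover have "expectation (\<lambda>\<omega>. (\<Sum>i\<in>{m..<Suc n}. X i \<omega>)\<^sup>2)
        = expectation (\<lambda>\<omega>. (?S \<omega>)\<^sup>2 + (X n \<omega>)\<^sup>2 + 2 * (?S \<omega> * X n \<omega>))"
      using True by (simp add: power2_sum algebra_simps)
    ultimately show ?thesis using S2 sq Suc True by simp
  qed simp
qed simp

text \<open>Decompose the event according to the first time \<open>k\<close> at which the partial sum reaches \<open>\<epsilon>\<close>. On this piece
  \<open>S\<^sub>n = S\<^sub>k + R\<close> with \<open>R\<close> independent of the past, so the cross term has mean \<open>0\<close> and the second moment of
  \<open>S\<^sub>n\<close> over the piece is at least \<open>\<epsilon>\<^sup>2\<close> times its probability.\<close>

lemma kolmogorov_maximal_inequality:
  fixes X :: "nat \<Rightarrow> 'a \<Rightarrow> real"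
  assumes X: "indep_vars (\<lambda>_. borel) X UNIV"
    and mean: "\<And>i. expectation (X i) = 0" and sq: "\<And>i. integrable M (\<lambda>\<omega>. (X i \<omega>)\<^sup>2)"
    and \<epsilon>: "\<epsilon> > 0"
  shows "prob {\<omega>\<in>space M. \<exists>k\<in>{m..n}. \<epsilon> \<le> \<bar>\<Sum>i\<in>{m..<k}. X i \<omega>\<bar>}
    \<le> (\<Sum>i\<in>{m..<n}. expectation (\<lambda>\<omega>. (X i \<omega>)\<^sup>2)) / \<epsilon>\<^sup>2"
proof -
  define S where "S k \<omega> = (\<Sum>i\<in>{m..<k}. X i \<omega>)" for k \<omega>
  have [measurable]: "X i \<in> borel_measurable M" for i using X by (auto simp: indep_vars_def)
  have Xi: "integrable M (X i)" for i by (rule square_integrable_imp_integrable) (auto simp: sq)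
  have [measurable]: "S k \<in> borel_measurable M" for k by (simp add: S_def[abs_def])
  have S2: "integrable M (\<lambda>\<omega>. (S k \<omega>)\<^sup>2)" for k
    unfolding S_def by (rule square_integrable_sum) (auto simp: sq)
  have ind_int: "integrable M (\<lambda>\<omega>. indicator A \<omega> * f \<omega>)" if "A \<in> sets M" "integrable M f" for A and f :: "'a \<Rightarrow> real"
    using integrable_mult_indicator[OF that] by simp
  define A where "A k = {\<omega>\<in>space M. \<epsilon> \<le> \<bar>S k \<omega>\<bar> \<and> (\<forall>j\<in>{m..<k}. \<bar>S j \<omega>\<bar> < \<epsilon>)}" for k
  have [measurable]: "A k \<in> sets M" for k unfolding A_def by measurable
  have disj: "disjoint_family_on A {m..n}"
    unfolding disjoint_family_on_def A_def
  proof (intro ballI impI, rule ccontr)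
    fix a b assume ab: "a \<in> {m..n}" "b \<in> {m..n}" "a \<noteq> b"
      and "{\<omega> \<in> space M. \<epsilon> \<le> \<bar>S a \<omega>\<bar> \<and> (\<forall>j\<in>{m..<a}. \<bar>S j \<omega>\<bar> < \<epsilon>)} \<inter>
        {\<omega> \<in> space M. \<epsilon> \<le> \<bar>S b \<omega>\<bar> \<and> (\<forall>j\<in>{m..<b}. \<bar>S j \<omega>\<bar> < \<epsilon>)} \<noteq> {}"
    then obtain \<omega> where \<omega>: "\<epsilon> \<le> \<bar>S a \<omega>\<bar>" "\<forall>j\<in>{m..<a}. \<bar>S j \<omega>\<bar> < \<epsilon>"
        "\<epsilon> \<le> \<bar>S b \<omega>\<bar>" "\<forall>j\<in>{m..<b}. \<bar>S j \<omega>\<bar> < \<epsilon>" by blast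
    show False
    proof (cases "a < b")
      case True
      then show False using \<omega>(1,4) ab by force
    next
      case False
      then have "b < a" using ab by simp
      then show False using \<omega>(2,3) ab by force
    qed
  qed
  have union: "{\<omega>\<in>space M. \<exists>k\<in>{m..n}. \<epsilon> \<le> \<bar>\<Sum>i\<in>{m..<k}. X i \<omega>\<bar>} = (\<Union>k\<in>{m..n}. A k)" (is "?L = ?R")
  proof (intro set_eqI iffI)
    fix \<omega> assume "\<omega> \<in> ?L"
    then have ex: "\<exists>k. k \<in> {m..n} \<and> \<epsilon> \<le> \<bar>S k \<omega>\<bar>" and sp: "\<omega> \<in> space M" by (auto simp: S_def)
    define k where "k = (LEAST k. k \<in> {m..n} \<and> \<epsilon> \<le> \<bar>S k \<omega>\<bar>)"
    have k: "k \<in> {m..n} \<and> \<epsilon> \<le> \<bar>S k \<omega>\<bar>" using LeastI_ex[OF ex] unfolding k_def .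
    have "\<bar>S j \<omega>\<bar> < \<epsilon>" if "j \<in> {m..<k}" for j
      using not_less_Least[of j "\<lambda>k. k \<in> {m..n} \<and> \<epsilon> \<le> \<bar>S k \<omega>\<bar>"] that k unfolding k_def[symmetric] by force
    then show "\<omega> \<in> ?R" using k sp unfolding A_def by blast
  qed (auto simp: A_def S_def)
  have piece: "\<epsilon>\<^sup>2 * prob (A k) \<le> expectation (\<lambda>\<omega>. indicator (A k) \<omega> * (S n \<omega>)\<^sup>2)" if k: "k \<in> {m..n}" for k
  proof -
    define R where "R \<omega> = (\<Sum>i\<in>{k..<n}. X i \<omega>)" for \<omega>
    have [measurable]: "R \<in> borel_measurable M" by (simp add: R_def[abs_def])
    have R1: "integrable M R" unfolding R_def[abs_def] using Xi by auto
    have R2: "integrable M (\<lambda>\<omega>. (R \<omega>)\<^sup>2)" unfolding R_def by (rule square_integrable_sum) (auto simp: sq)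
    have SnR: "S n \<omega> = S k \<omega> + R \<omega>" for \<omega>
      unfolding S_def R_def using k by (simp add: sum.atLeastLessThan_concat)
    have ER: "expectation R = 0" unfolding R_def[abs_def] using Xi mean by simp
    define T where "T x j = (\<Sum>i\<in>{m..<j}. x i)" for x :: "nat \<Rightarrow> real" and j
    define f where "f x = (if \<epsilon> \<le> \<bar>T x k\<bar> \<and> (\<forall>j\<in>{m..<k}. \<bar>T x j\<bar> < \<epsilon>) then 1 else 0) * T x k" for x
    have Tm [measurable]: "(\<lambda>x. T x j) \<in> borel_measurable (PiM {m..<k} (\<lambda>_. borel))" if "j \<le> k" for j
      unfolding T_def using that by (intro borel_measurable_sum measurable_component_singleton) auto
    have fm: "f \<in> borel_measurable (PiM {m..<k} (\<lambda>_. borel))"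
    proof -
      have [measurable]: "(\<lambda>x. T x k) \<in> borel_measurable (PiM {m..<k} (\<lambda>_. borel))" by (rule Tm) simp
      have [measurable]: "Measurable.pred (PiM {m..<k} (\<lambda>_. borel)) (\<lambda>x. \<forall>j\<in>{m..<k}. \<bar>T x j\<bar> < \<epsilon>)"
        using Tm by (intro pred_intros_finite) (auto intro!: borel_measurable_pred_less)
      show ?thesis unfolding f_def[abs_def] by measurable
    qed
    have gm: "(\<lambda>x. \<Sum>i\<in>{k..<n}. x i) \<in> borel_measurable (PiM {k..<n} (\<lambda>_. borel :: real measure))"
      by (intro borel_measurable_sum measurable_component_singleton) auto
    have ind: "indep_var borel (\<lambda>\<omega>. f (\<lambda>i\<in>{m..<k}. X i \<omega>)) borel R"
      using indep_blocks[OF X _ fm gm] by (simp add: R_def[abs_def])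
    have Trestr: "T (\<lambda>i\<in>{m..<k}. X i \<omega>) j = S j \<omega>" if "j \<le> k" for j \<omega>
      unfolding T_def S_def using that by (intro sum.cong) auto
    have feq: "f (\<lambda>i\<in>{m..<k}. X i \<omega>) = indicator (A k) \<omega> * S k \<omega>" if "\<omega> \<in> space M" for \<omega>
      using that unfolding f_def A_def by (auto simp: Trestr)
    have fi: "integrable M (\<lambda>\<omega>. f (\<lambda>i\<in>{m..<k}. X i \<omega>))"
    proof -
      have "integrable M (S k)" unfolding S_def[abs_def] using Xi by auto
      then have "integrable M (\<lambda>\<omega>. indicator (A k) \<omega> * S k \<omega>)" by (intro ind_int) auto
      then show ?thesis using feq by (simp cong: Bochner_Integration.integrable_cong)
    qed
    have cross: "expectation (\<lambda>\<omega>. (indicator (A k) \<omega> * S k \<omega>) * R \<omega>) = 0"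
    proof -
      have "expectation (\<lambda>\<omega>. (indicator (A k) \<omega> * S k \<omega>) * R \<omega>) = expectation (\<lambda>\<omega>. f (\<lambda>i\<in>{m..<k}. X i \<omega>) * R \<omega>)"
        using feq by (intro Bochner_Integration.integral_cong) auto
      then show ?thesis using indep_var_lebesgue_integral[OF ind fi R1] ER by simp
    qed
    have cross_int: "integrable M (\<lambda>\<omega>. (indicator (A k) \<omega> * S k \<omega>) * R \<omega>)"
    proof (rule product_integrable_of_squares)
      have "integrable M (\<lambda>\<omega>. indicator (A k) \<omega> * (S k \<omega>)\<^sup>2)"
        using S2 by (intro ind_int) auto
      moreover have "(\<lambda>\<omega>. (indicator (A k) \<omega> * S k \<omega>)\<^sup>2) = (\<lambda>\<omega>. indicator (A k) \<omega> * (S k \<omega>)\<^sup>2)"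
        by (auto simp: indicator_def)
      ultimately show "integrable M (\<lambda>\<omega>. (indicator (A k) \<omega> * S k \<omega>)\<^sup>2)" by simp
    qed (use R2 in auto)
    have "\<epsilon>\<^sup>2 * prob (A k) = expectation (\<lambda>\<omega>. \<epsilon>\<^sup>2 * indicator (A k) \<omega>)" by simp
    also have "\<dots> \<le> expectation (\<lambda>\<omega>. indicator (A k) \<omega> * (S n \<omega>)\<^sup>2 - 2 * ((indicator (A k) \<omega> * S k \<omega>) * R \<omega>))"
    proof (rule integral_mono)
      show "integrable M (\<lambda>\<omega>. indicator (A k) \<omega> * (S n \<omega>)\<^sup>2 - 2 * ((indicator (A k) \<omega> * S k \<omega>) * R \<omega>))"
        using S2 cross_int by (auto intro!: ind_int)
      fix \<omega>
      show "\<epsilon>\<^sup>2 * indicator (A k) \<omega> \<le> indicator (A k) \<omega> * (S n \<omega>)\<^sup>2 - 2 * ((indicator (A k) \<omega> * S k \<omega>) * R \<omega>)"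
      proof (cases "\<omega> \<in> A k")
        case True
        then have "\<epsilon> \<le> \<bar>S k \<omega>\<bar>" by (auto simp: A_def)
        then have "\<epsilon>\<^sup>2 \<le> (S k \<omega>)\<^sup>2" using \<epsilon> by (metis less_imp_le power2_abs power_mono)
        moreover have "(S n \<omega>)\<^sup>2 - 2 * (S k \<omega> * R \<omega>) = (S k \<omega>)\<^sup>2 + (R \<omega>)\<^sup>2"
          unfolding SnR by (simp add: power2_sum)
        ultimately show ?thesis using True by (simp add: add_increasing2)
      qed simp
    qed (auto simp: emeasure_eq_measure)
    also have "\<dots> = expectation (\<lambda>\<omega>. indicator (A k) \<omega> * (S n \<omega>)\<^sup>2)"
      using S2 cross_int cross by (subst Bochner_Integration.integral_diff) (auto intro!: ind_int)
    finally show ?thesis .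
  qed
  have "\<epsilon>\<^sup>2 * prob (\<Union>k\<in>{m..n}. A k) = (\<Sum>k\<in>{m..n}. \<epsilon>\<^sup>2 * prob (A k))"
    using disj by (subst finite_measure_finite_Union) (auto simp: sum_distrib_left)
  also have "\<dots> \<le> (\<Sum>k\<in>{m..n}. expectation (\<lambda>\<omega>. indicator (A k) \<omega> * (S n \<omega>)\<^sup>2))"
    by (intro sum_mono piece)
  also have "\<dots> = expectation (\<lambda>\<omega>. \<Sum>k\<in>{m..n}. indicator (A k) \<omega> * (S n \<omega>)\<^sup>2)"
    using S2 by (intro Bochner_Integration.integral_sum[symmetric] ind_int) auto
  also have "\<dots> \<le> expectation (\<lambda>\<omega>. (S n \<omega>)\<^sup>2)"
  proof (rule integral_mono)
    show "integrable M (\<lambda>\<omega>. \<Sum>k\<in>{m..n}. indicator (A k) \<omega> * (S n \<omega>)\<^sup>2)"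
      using S2 by (intro Bochner_Integration.integrable_sum ind_int) auto
    fix \<omega>
    have "(\<Sum>k\<in>{m..n}. indicator (A k) \<omega> * (S n \<omega>)\<^sup>2) = (\<Sum>k\<in>{m..n}. indicator (A k) \<omega>) * (S n \<omega>)\<^sup>2"
      by (simp add: sum_distrib_right)
    also have "(\<Sum>k\<in>{m..n}. indicator (A k) \<omega>) = (indicator (\<Union>k\<in>{m..n}. A k) \<omega> :: real)"
      using disj by (intro indicator_UN_disjoint[symmetric]) auto
    also have "\<dots> * (S n \<omega>)\<^sup>2 \<le> (S n \<omega>)\<^sup>2" by (simp add: indicator_def)
    finally show "(\<Sum>k\<in>{m..n}. indicator (A k) \<omega> * (S n \<omega>)\<^sup>2) \<le> (S n \<omega>)\<^sup>2" .
  qed (rule S2)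
  also have "\<dots> = (\<Sum>i\<in>{m..<n}. expectation (\<lambda>\<omega>. (X i \<omega>)\<^sup>2))"
    unfolding S_def by (rule second_moment_sum[OF X mean sq])
  finally show ?thesis using \<epsilon> union by (simp add: pos_le_divide_eq mult.commute)
qed

text \<open>By the maximal inequality the probability that the oscillation after time \<open>m\<close> reaches \<open>\<epsilon>\<close> is at most
  the tail of the variances divided by \<open>\<epsilon>\<^sup>2\<close>, hence tends to \<open>0\<close>; so almost surely the partial sums are
  Cauchy.\<close>

theorem kolmogorov_series:
  fixes X :: "nat \<Rightarrow> 'a \<Rightarrow> real"
  assumes X: "indep_vars (\<lambda>_. borel) X UNIV"
    and mean: "\<And>i. expectation (X i) = 0" and sq: "\<And>i. integrable M (\<lambda>\<omega>. (X i \<omega>)\<^sup>2)"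
    and var: "summable (\<lambda>i. expectation (\<lambda>\<omega>. (X i \<omega>)\<^sup>2))"
  shows "AE \<omega> in M. summable (\<lambda>i. X i \<omega>)"
proof -
  define v where "v i = expectation (\<lambda>\<omega>. (X i \<omega>)\<^sup>2)" for i
  have v: "summable v" "\<And>i. 0 \<le> v i" using var by (auto simp: v_def[abs_def])
  define S where "S m k \<omega> = (\<Sum>i\<in>{m..<k}. X i \<omega>)" for m k \<omega>
  have [measurable]: "X i \<in> borel_measurable M" for i using X by (auto simp: indep_vars_def)
  have [measurable]: "S m k \<in> borel_measurable M" for m k by (simp add: S_def[abs_def])
  have tail: "prob {\<omega>\<in>space M. \<exists>k\<ge>m. \<epsilon> \<le> \<bar>S m k \<omega>\<bar>} \<le> (\<Sum>i. v (i + m)) / \<epsilon>\<^sup>2" if \<epsilon>: "\<epsilon> > 0" for m \<epsilon>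
  proof -
    let ?E = "\<lambda>n. {\<omega>\<in>space M. \<exists>k\<in>{m..n}. \<epsilon> \<le> \<bar>S m k \<omega>\<bar>}"
    have "(\<lambda>n. prob (?E n)) \<longlonglongrightarrow> prob (\<Union>n. ?E n)"
      by (intro finite_Lim_measure_incseq) (auto simp: incseq_def)
    also have "(\<Union>n. ?E n) = {\<omega>\<in>space M. \<exists>k\<ge>m. \<epsilon> \<le> \<bar>S m k \<omega>\<bar>}" (is "_ = ?R")
    proof (intro equalityI subsetI)
      fix \<omega> assume "\<omega> \<in> ?R"
      then obtain k where "k \<ge> m" "\<epsilon> \<le> \<bar>S m k \<omega>\<bar>" "\<omega> \<in> space M" by blast
      then have "\<omega> \<in> ?E k" by auto
      then show "\<omega> \<in> (\<Union>n. ?E n)" by blast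
    qed auto
    finally show ?thesis
    proof (rule LIMSEQ_le_const2)
      have "prob (?E n) \<le> (\<Sum>i. v (i + m)) / \<epsilon>\<^sup>2" for n
      proof -
        have "prob (?E n) \<le> (\<Sum>i\<in>{m..<n}. v i) / \<epsilon>\<^sup>2"
          unfolding S_def v_def by (rule kolmogorov_maximal_inequality[OF X mean sq \<epsilon>])
        also have "(\<Sum>i\<in>{m..<n}. v i) = (\<Sum>i<n - m. v (i + m))"
          using sum.shift_bounds_nat_ivl[of v 0 m "n - m"] by (cases "m \<le> n") (auto simp: atLeast0LessThan)
        also have "\<dots> \<le> (\<Sum>i. v (i + m))"
          using v by (intro sum_le_suminf) (auto simp: summable_iff_shift)
        finally show ?thesis by (simp add: divide_right_mono)
      qed
      then show "\<exists>N. \<forall>n\<ge>N. prob (?E n) \<le> (\<Sum>i. v (i + m)) / \<epsilon>\<^sup>2" by blast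
    qed
  qed
  have lim0: "(\<lambda>m. \<Sum>i. v (i + m)) \<longlonglongrightarrow> 0"
    using suminf_exist_split2[OF v(1)] by simp
  have ae: "AE \<omega> in M. \<exists>m. \<forall>k\<ge>m. \<bar>S m k \<omega>\<bar> < \<epsilon>" if \<epsilon>: "\<epsilon> > 0" for \<epsilon>
  proof -
    let ?N = "{\<omega>\<in>space M. \<forall>m. \<exists>k\<ge>m. \<epsilon> \<le> \<bar>S m k \<omega>\<bar>}"
    have "prob ?N \<le> (\<Sum>i. v (i + m)) / \<epsilon>\<^sup>2" for m
      by (rule order_trans[OF finite_measure_mono tail[OF \<epsilon>, of m]]) auto
    moreover have "(\<lambda>m. (\<Sum>i. v (i + m)) / \<epsilon>\<^sup>2) \<longlonglongrightarrow> 0"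
      using tendsto_divide[OF lim0 tendsto_const[of "\<epsilon>\<^sup>2"]] \<epsilon> by simp
    ultimately have "prob ?N \<le> 0" by (intro LIMSEQ_le_const) auto
    then have "prob ?N = 0" by (simp add: measure_le_0_iff)
    moreover have "?N \<in> sets M" by measurable
    ultimately have "AE \<omega> in M. \<omega> \<notin> ?N" by (simp add: prob_eq_0)
    then show ?thesis using AE_space by eventually_elim (simp add: not_le, metis not_le)
  qed
  have "AE \<omega> in M. \<forall>j. \<exists>m. \<forall>k\<ge>m. \<bar>S m k \<omega>\<bar> < 1 / real (Suc j)"
    by (simp add: AE_all_countable ae)
  then show ?thesis
  proof eventually_elim
    case (elim \<omega>)
    show ?case unfolding summable_Cauchy
    proof (intro allI impI)
      fix e :: real assume "e > 0"
      then obtain j where j: "1 / real (Suc j) < e / 2" using nat_approx_posE[of "e / 2"] by auto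
      obtain m where m: "\<And>k. k \<ge> m \<Longrightarrow> \<bar>S m k \<omega>\<bar> < e / 2" using elim j by (meson order_less_trans)
      have "norm (sum (\<lambda>i. X i \<omega>) {a..<b}) < e" if "a \<ge> m" for a b
      proof (cases "a \<le> b")
        case True
        have "S m a \<omega> + sum (\<lambda>i. X i \<omega>) {a..<b} = S m b \<omega>"
          unfolding S_def using True that by (simp add: sum.atLeastLessThan_concat)
        then show ?thesis using m[of a] m[of b] True that by simp
      qed (use \<open>e > 0\<close> in simp)
      then show "\<exists>N. \<forall>m\<ge>N. \<forall>n. norm (sum (\<lambda>i. X i \<omega>) {m..<n}) < e" by blast
    qed
  qed
qed
end

section \<open>Centred Gaussian variables\<close>

text \<open>The normal law is described as the image of the standard normal law under scaling, so that the
  degenerate case \<open>v = 0\<close> is included. This makes the class closed under limits.\<close>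

definition centred_gaussian :: "'a measure \<Rightarrow> real \<Rightarrow> ('a \<Rightarrow> real) \<Rightarrow> bool" where
  "centred_gaussian M v Z \<longleftrightarrow> 0 \<le> v \<and> Z \<in> borel_measurable M \<and>
     distr M borel Z = distr std_normal_distribution borel (\<lambda>x. sqrt v * x)"

lemma char_scaled_normal:
  assumes "0 \<le> v"
  shows "char (distr std_normal_distribution borel (\<lambda>x. sqrt v * x)) \<theta> = complex_of_real (exp (- (\<theta>\<^sup>2 * v) / 2))"
proof -
  have "char (distr std_normal_distribution borel (\<lambda>x. sqrt v * x)) \<theta> = char std_normal_distribution (\<theta> * sqrt v)"
    unfolding char_def by (subst integral_distr) (auto simp: mult.assoc)
  also have "\<dots> = complex_of_real (exp (- (\<theta>\<^sup>2 * v) / 2))"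
    using assms by (simp add: char_std_normal_distribution power_mult_distrib)
  finally show ?thesis .
qed

context prob_space begin

lemma centred_gaussianI_char:
  assumes "0 \<le> v" and Z [measurable]: "Z \<in> borel_measurable M"
    and char: "\<And>\<theta>. char (distr M borel Z) \<theta> = complex_of_real (exp (- (\<theta>\<^sup>2 * v) / 2))"
  shows "centred_gaussian M v Z"
proof -
  interpret N: prob_space std_normal_distribution by (rule prob_space_normal_density) simp
  have "distr M borel Z = distr std_normal_distribution borel (\<lambda>x. sqrt v * x)"
  proof (rule Levy_uniqueness)
    show "real_distribution (distr M borel Z)"
      by (rule real_distribution_distr) measurable
    show "real_distribution (distr std_normal_distribution borel (\<lambda>x. sqrt v * x))"
      by (rule N.real_distribution_distr) simp
  qed (simp add: fun_eq_iff char char_scaled_normal \<open>0 \<le> v\<close>)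
  then show ?thesis using assms by (simp add: centred_gaussian_def)
qed

lemma centred_gaussian_measurable: "centred_gaussian M v Z \<Longrightarrow> Z \<in> borel_measurable M"
  by (simp add: centred_gaussian_def)

lemma centred_gaussian_integral:
  fixes g :: "real \<Rightarrow> real"
  assumes Z: "centred_gaussian M v Z" and [measurable]: "g \<in> borel_measurable borel"
  shows "expectation (\<lambda>\<omega>. g (Z \<omega>)) = (\<integral>x. g (sqrt v * x) \<partial>std_normal_distribution)"
    and "integrable M (\<lambda>\<omega>. g (Z \<omega>)) \<longleftrightarrow> integrable std_normal_distribution (\<lambda>x. g (sqrt v * x))"
proof -
  have [measurable]: "Z \<in> borel_measurable M"
    and D: "distr M borel Z = distr std_normal_distribution borel (\<lambda>x. sqrt v * x)"
    using Z by (auto simp: centred_gaussian_def)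
  have "expectation (\<lambda>\<omega>. g (Z \<omega>)) = (\<integral>x. g x \<partial>distr M borel Z)" by (simp add: integral_distr)
  then show "expectation (\<lambda>\<omega>. g (Z \<omega>)) = (\<integral>x. g (sqrt v * x) \<partial>std_normal_distribution)"
    unfolding D by (simp add: integral_distr)
  have "integrable M (\<lambda>\<omega>. g (Z \<omega>)) \<longleftrightarrow> integrable (distr M borel Z) g" by (simp add: integrable_distr_eq)
  then show "integrable M (\<lambda>\<omega>. g (Z \<omega>)) \<longleftrightarrow> integrable std_normal_distribution (\<lambda>x. g (sqrt v * x))"
    unfolding D by (simp add: integrable_distr_eq)
qed

lemma centred_gaussian_moments:
  assumes Z: "centred_gaussian M v Z"
  shows "integrable M Z" "expectation Z = 0"
    "integrable M (\<lambda>\<omega>. (Z \<omega>)\<^sup>2)" "expectation (\<lambda>\<omega>. (Z \<omega>)\<^sup>2) = v"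
    "expectation (\<lambda>\<omega>. \<bar>Z \<omega>\<bar>) = sqrt v * (\<integral>x. \<bar>x\<bar> \<partial>std_normal_distribution)"
proof -
  have v: "0 \<le> v" using Z by (simp add: centred_gaussian_def)
  show "integrable M Z"
    using centred_gaussian_integral(2)[OF Z, of "\<lambda>x. x"] integrable_std_normal_distribution_moment[of 1] by simp
  show "expectation Z = 0"
    using centred_gaussian_integral(1)[OF Z, of "\<lambda>x. x"] integral_std_normal_distribution_moment_odd[of 1] by simp
  show "integrable M (\<lambda>\<omega>. (Z \<omega>)\<^sup>2)"
    using centred_gaussian_integral(2)[OF Z, of "\<lambda>x. x\<^sup>2"] integrable_std_normal_distribution_moment[of 2]
    by (simp add: power_mult_distrib)
  show "expectation (\<lambda>\<omega>. (Z \<omega>)\<^sup>2) = v"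
    using centred_gaussian_integral(1)[OF Z, of "\<lambda>x. x\<^sup>2"] std_normal_distribution_even_moments(1)[of 1] v
    by (simp add: power_mult_distrib)
  show "expectation (\<lambda>\<omega>. \<bar>Z \<omega>\<bar>) = sqrt v * (\<integral>x. \<bar>x\<bar> \<partial>std_normal_distribution)"
    using centred_gaussian_integral(1)[OF Z, of "\<lambda>x. \<bar>x\<bar>"] v by (simp add: abs_mult)
qed

lemma centred_gaussian_variance: "centred_gaussian M v Z \<Longrightarrow> variance Z = v"
  by (simp add: centred_gaussian_moments)

lemma centred_gaussian_char:
  assumes Z: "centred_gaussian M v Z"
  shows "char (distr M borel Z) \<theta> = complex_of_real (exp (- (\<theta>\<^sup>2 * v) / 2))"
  using Z char_scaled_normal by (simp add: centred_gaussian_def)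

lemma centred_gaussian_scale:
  assumes Z: "centred_gaussian M v Z"
  shows "centred_gaussian M (a\<^sup>2 * v) (\<lambda>\<omega>. a * Z \<omega>)"
proof -
  have [measurable]: "Z \<in> borel_measurable M" and "0 \<le> v" using Z by (auto simp: centred_gaussian_def)
  show ?thesis
  proof (rule centred_gaussianI_char)
    fix \<theta>
    have "char (distr M borel (\<lambda>\<omega>. a * Z \<omega>)) \<theta> = char (distr M borel Z) (\<theta> * a)"
      unfolding char_def by (simp add: integral_distr mult.assoc)
    then show "char (distr M borel (\<lambda>\<omega>. a * Z \<omega>)) \<theta> = complex_of_real (exp (- (\<theta>\<^sup>2 * (a\<^sup>2 * v)) / 2))"
      using centred_gaussian_char[OF Z] by (simp add: power_mult_distrib mult.assoc)
  qed (use \<open>0 \<le> v\<close> in auto)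
qed

lemma centred_gaussian_cos:
  assumes Z: "centred_gaussian M v Z"
  shows "expectation (\<lambda>\<omega>. cos (Z \<omega>)) = exp (- v / 2)"
proof -
  have [measurable]: "Z \<in> borel_measurable M" using Z by (rule centred_gaussian_measurable)
  have "complex_of_real (exp (- v / 2)) = (CLINT \<omega>|M. iexp (1 * Z \<omega>))"
    using centred_gaussian_char[OF Z, of 1] unfolding char_def by (simp add: integral_distr)
  then have "exp (- v / 2) = Re (CLINT \<omega>|M. iexp (1 * Z \<omega>))" by (metis Re_complex_of_real)
  also have "\<dots> = expectation (\<lambda>\<omega>. Re (iexp (1 * Z \<omega>)))"
    by (intro integral_Re[symmetric] integrable_iexp) auto
  finally show ?thesis by (simp add: Re_exp)
qed

text \<open>The characteristic functions \<open>exp (- \<theta>\<^sup>2 v\<^sub>n / 2)\<close> converge to that of the limit, which is continuous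
  with value 1 at the origin and hence nonzero at some \<open>\<theta> \<noteq> 0\<close>. Taking logarithms at this \<open>\<theta>\<close> shows
  that the variances converge, and then all the characteristic functions are identified.\<close>

lemma centred_gaussian_AE_limit:
  assumes Zn: "\<And>n. centred_gaussian M (v n) (Z n)" and Y [measurable]: "Y \<in> borel_measurable M"
    and lim: "AE \<omega> in M. (\<lambda>n. Z n \<omega>) \<longlonglongrightarrow> Y \<omega>"
  shows "\<exists>w. v \<longlonglongrightarrow> w \<and> centred_gaussian M w Y"
proof -
  have [measurable]: "Z n \<in> borel_measurable M" for n using Zn by (rule centred_gaussian_measurable)
  have v: "0 \<le> v n" for n using Zn[of n] by (simp add: centred_gaussian_def)
  define \<phi> where "\<phi> = char (distr M borel Y)"
  interpret D: real_distribution "distr M borel Y" by (rule real_distribution_distr) measurable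
  have conv: "(\<lambda>n. complex_of_real (exp (- (\<theta>\<^sup>2 * v n) / 2))) \<longlonglongrightarrow> \<phi> \<theta>" for \<theta>
  proof -
    have "(\<lambda>n. CLINT \<omega>|M. iexp (\<theta> * Z n \<omega>)) \<longlonglongrightarrow> (CLINT \<omega>|M. iexp (\<theta> * Y \<omega>))"
    proof (rule integral_dominated_convergence[where w = "\<lambda>_. 1"])
      show "AE \<omega> in M. (\<lambda>n. iexp (\<theta> * Z n \<omega>)) \<longlonglongrightarrow> iexp (\<theta> * Y \<omega>)"
        using lim by eventually_elim (intro tendsto_intros)
    qed auto
    moreover have "(CLINT \<omega>|M. iexp (\<theta> * Z n \<omega>)) = complex_of_real (exp (- (\<theta>\<^sup>2 * v n) / 2))" for n
      using centred_gaussian_char[OF Zn, of n \<theta>] unfolding char_def by (simp add: integral_distr)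
    moreover have "(CLINT \<omega>|M. iexp (\<theta> * Y \<omega>)) = \<phi> \<theta>"
      unfolding \<phi>_def char_def by (simp add: integral_distr)
    ultimately show ?thesis by simp
  qed
  have "isCont \<phi> 0" "\<phi> 0 = 1" unfolding \<phi>_def using D.isCont_char D.char_zero by auto
  then have "\<forall>\<^sub>F \<theta> in at 0. dist (\<phi> \<theta>) 1 < 1"
    unfolding isCont_def by (metis tendstoD zero_less_one)
  moreover have "\<forall>\<^sub>F \<theta> in at 0. \<theta> \<noteq> (0::real)" by (simp add: eventually_at_filter)
  ultimately have "\<forall>\<^sub>F \<theta> in at (0::real). \<theta> \<noteq> 0 \<and> \<phi> \<theta> \<noteq> 0"
    by eventually_elim auto
  then obtain \<theta> where \<theta>: "\<theta> \<noteq> 0" "\<phi> \<theta> \<noteq> 0"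
    using eventually_happens[of _ "at (0::real)"] by (auto simp: trivial_limit_at)
  have re: "(\<lambda>n. exp (- (\<theta>\<^sup>2 * v n) / 2)) \<longlonglongrightarrow> Re (\<phi> \<theta>)"
    using tendsto_Re[OF conv[of \<theta>]] by simp
  have "(\<lambda>n. Im (complex_of_real (exp (- (\<theta>\<^sup>2 * v n) / 2)))) \<longlonglongrightarrow> Im (\<phi> \<theta>)"
    by (rule tendsto_Im[OF conv])
  then have "Im (\<phi> \<theta>) = 0" by (simp add: LIMSEQ_const_iff)
  then have "Re (\<phi> \<theta>) \<noteq> 0" using \<theta>(2) by (simp add: complex_eq_iff)
  moreover have "Re (\<phi> \<theta>) \<ge> 0" by (rule LIMSEQ_le_const[OF re]) auto
  ultimately have pos: "Re (\<phi> \<theta>) > 0" by simp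
  define w where "w = - 2 * ln (Re (\<phi> \<theta>)) / \<theta>\<^sup>2"
  have "(\<lambda>n. - 2 * ln (exp (- (\<theta>\<^sup>2 * v n) / 2)) / \<theta>\<^sup>2) \<longlonglongrightarrow> w"
    unfolding w_def using \<theta> pos by (intro tendsto_intros re) auto
  then have vw: "v \<longlonglongrightarrow> w" using \<theta>(1) by simp
  have "centred_gaussian M w Y"
  proof (rule centred_gaussianI_char)
    show "0 \<le> w" using vw by (rule LIMSEQ_le_const) (use v in auto)
    fix \<theta>'
    have "(\<lambda>n. complex_of_real (exp (- (\<theta>'\<^sup>2 * v n) / 2))) \<longlonglongrightarrow> complex_of_real (exp (- (\<theta>'\<^sup>2 * w) / 2))"
      by (intro tendsto_intros vw) auto
    then show "char (distr M borel Y) \<theta>' = complex_of_real (exp (- (\<theta>'\<^sup>2 * w) / 2))"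
      using conv[of \<theta>'] LIMSEQ_unique unfolding \<phi>_def by blast
  qed measurable
  then show ?thesis using vw by blast
qed

lemma centred_gaussian_normally_distributed:
  assumes Z: "centred_gaussian M v Z"
  shows "normally_distributed M Z"
proof (cases "v = 0")
  case True
  have [measurable]: "Z \<in> borel_measurable M" using Z by (rule centred_gaussian_measurable)
  have "expectation (\<lambda>\<omega>. (Z \<omega>)\<^sup>2) = 0" using centred_gaussian_moments(4)[OF Z] True by simp
  then have "AE \<omega> in M. (Z \<omega>)\<^sup>2 = 0"
    using centred_gaussian_moments(3)[OF Z] by (subst (asm) integral_nonneg_eq_0_iff_AE) auto
  then have "AE \<omega> in M. Z \<omega> = 0" by simp
  then show ?thesis unfolding normally_distributed_def by (intro exI[of _ 0]) simp
next
  case False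
  have [measurable]: "Z \<in> borel_measurable M" using Z by (rule centred_gaussian_measurable)
  have v: "0 < v" using Z False by (simp add: centred_gaussian_def)
  interpret N: prob_space std_normal_distribution by (rule prob_space_normal_density) simp
  have "distributed std_normal_distribution lborel (\<lambda>x. x) std_normal_density"
    unfolding distributed_def by (auto simp: distr_id2)
  then have "distributed std_normal_distribution lborel (\<lambda>x. 0 + sqrt v * x) (normal_density (0 + sqrt v * 0) (\<bar>sqrt v\<bar> * 1))"
    using v by (intro N.normal_density_affine) auto
  then have "distr std_normal_distribution lborel (\<lambda>x. sqrt v * x) = density lborel (normal_density 0 (sqrt v))"
    using v unfolding distributed_def by simp
  moreover have "distr std_normal_distribution lborel (\<lambda>x. sqrt v * x) = distr std_normal_distribution borel (\<lambda>x. sqrt v * x)"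
    by (intro distr_cong) auto
  moreover have "distr M lborel Z = distr M borel Z" by (intro distr_cong) auto
  ultimately have "distributed M lborel Z (normal_density 0 (sqrt v))"
    using Z unfolding distributed_def centred_gaussian_def by simp
  then show ?thesis unfolding normally_distributed_def using v by (metis real_sqrt_gt_zero)
qed

lemma centred_gaussian_sum:
  assumes ind: "indep_vars (\<lambda>_. borel) Y I" and "finite I"
    and Y: "\<And>i. i \<in> I \<Longrightarrow> distributed M lborel (Y i) std_normal_density"
  shows "centred_gaussian M (\<Sum>i\<in>I. (c i)\<^sup>2) (\<lambda>\<omega>. \<Sum>i\<in>I. c i * Y i \<omega>)"
proof (rule centred_gaussianI_char)
  have [measurable]: "Y i \<in> borel_measurable M" if "i \<in> I" for i
    using ind that by (auto simp: indep_vars_def)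
  show "(\<lambda>\<omega>. \<Sum>i\<in>I. c i * Y i \<omega>) \<in> borel_measurable M" by measurable
  fix \<theta> :: real
  have "indep_vars (\<lambda>_. borel) (\<lambda>i \<omega>. c i * Y i \<omega>) I"
    using ind by (rule indep_vars_compose2) auto
  then have "char (distr M borel (\<lambda>\<omega>. \<Sum>i\<in>I. c i * Y i \<omega>)) \<theta> = (\<Prod>i\<in>I. char (distr M borel (\<lambda>\<omega>. c i * Y i \<omega>)) \<theta>)"
    by (rule char_distr_sum)
  also have "\<dots> = (\<Prod>i\<in>I. complex_of_real (exp (- (\<theta>\<^sup>2 * (c i)\<^sup>2) / 2)))"
  proof (intro prod.cong refl)
    fix i assume i: "i \<in> I"
    have "distr M borel (Y i) = distr M lborel (Y i)" by (intro distr_cong) auto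
    also have "\<dots> = std_normal_distribution" using Y[OF i] by (simp add: distributed_def)
    finally have D: "distr M borel (Y i) = std_normal_distribution" .
    have "char (distr M borel (\<lambda>\<omega>. c i * Y i \<omega>)) \<theta> = char (distr M borel (Y i)) (\<theta> * c i)"
      unfolding char_def using i by (simp add: integral_distr mult.assoc)
    then show "char (distr M borel (\<lambda>\<omega>. c i * Y i \<omega>)) \<theta> = complex_of_real (exp (- (\<theta>\<^sup>2 * (c i)\<^sup>2) / 2))"
      unfolding D by (simp add: char_std_normal_distribution power_mult_distrib)
  qed
  also have "\<dots> = complex_of_real (exp (\<Sum>i\<in>I. - (\<theta>\<^sup>2 * (c i)\<^sup>2) / 2))"
    using \<open>finite I\<close> by (simp add: exp_sum)
  also have "(\<Sum>i\<in>I. - (\<theta>\<^sup>2 * (c i)\<^sup>2) / 2) = - (\<theta>\<^sup>2 * (\<Sum>i\<in>I. (c i)\<^sup>2)) / 2"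
    by (simp add: sum_distrib_left sum_divide_distrib sum_negf)
  finally show "char (distr M borel (\<lambda>\<omega>. \<Sum>i\<in>I. c i * Y i \<omega>)) \<theta> = complex_of_real (exp (- (\<theta>\<^sup>2 * (\<Sum>i\<in>I. (c i)\<^sup>2)) / 2))" .
qed (simp add: sum_nonneg)

end

section \<open>Slowly decaying coefficients\<close>

definition log_coeff :: "nat \<Rightarrow> real" where
  "log_coeff i = 1 / (sqrt (real i + 2) * (ln (real i + 2))\<^sup>2)"

lemma log_coeff_nonneg: "0 \<le> log_coeff i"
  by (simp add: log_coeff_def)

lemma log_coeff_antimono: "i \<le> j \<Longrightarrow> log_coeff j \<le> log_coeff i"
  unfolding log_coeff_def by (intro divide_left_mono mult_mono power_mono mult_pos_pos) auto

lemma log_coeff_square: "(log_coeff i)\<^sup>2 = 1 / ((real i + 2) * ln (real i + 2) ^ 4)"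
  by (simp add: log_coeff_def power_divide power_mult_distrib flip: power_mult)

text \<open>Cauchy condensation turns the series into one with terms of order \<open>1 / n\<^sup>4\<close>.\<close>

lemma summable_log_coeff_square: "summable (\<lambda>i. (log_coeff i)\<^sup>2)"
proof -
  have "summable (\<lambda>n. 2 ^ n * (log_coeff (2 ^ n))\<^sup>2)"
  proof (rule summable_comparison_test_ev)
    show "summable (\<lambda>n. inverse (real n ^ 4) / ln 2 ^ 4)"
      by (intro summable_divide inverse_power_summable) simp
    show "\<forall>\<^sub>F n in sequentially. norm (2 ^ n * (log_coeff (2 ^ n))\<^sup>2) \<le> inverse (real n ^ 4) / ln 2 ^ 4"
      using eventually_gt_at_top[of 0]
    proof eventually_elim
      case (elim n)
      have "real n * ln 2 = ln (2 ^ n)" by (simp add: ln_realpow)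
      also have "\<dots> \<le> ln (2 ^ n + 2)" by (intro ln_mono) (auto intro: add_pos_pos)
      finally have l: "(real n * ln 2) ^ 4 \<le> ln (2 ^ n + 2) ^ 4" by (intro power_mono) auto
      have "norm (2 ^ n * (log_coeff (2 ^ n))\<^sup>2) = 2 ^ n / ((2 ^ n + 2) * ln (2 ^ n + 2) ^ 4)"
        by (simp add: log_coeff_square)
      also have "\<dots> \<le> (2 ^ n + 2) / ((2 ^ n + 2) * ln (2 ^ n + 2) ^ 4)"
        by (intro divide_right_mono) auto
      also have "\<dots> = 1 / ln (2 ^ n + 2) ^ 4"
        using less_imp_neq[of "0::real" "2 ^ n + 2"] by (simp add: add_pos_pos)
      also have "\<dots> \<le> 1 / (real n * ln 2) ^ 4"
        using elim l by (intro divide_left_mono) (auto intro!: mult_pos_pos zero_less_power ln_gt_zero add_pos_pos)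
      finally show ?case by (simp add: power_mult_distrib field_simps)
    qed
  qed
  then show ?thesis
    by (subst condensation_test) (auto intro!: power_mono log_coeff_antimono log_coeff_nonneg)
qed

lemma log_coeff_lower_bound:
  assumes n: "2 \<le> n"
  shows "(real n)\<^sup>2 / (243 * ln (real n) ^ 4) \<le> real n * (real n * log_coeff (2 * n))\<^sup>2"
proof -
  have lnn: "0 < ln (real n)" using n by simp
  \<comment> \<open>This gives \<open>ln (2 n + 2) \<le> 3 ln n\<close>, and with \<open>2 n + 2 \<le> 3 n\<close> the constant \<open>3 * 3\<^sup>4 = 243\<close>.\<close>
  have "2 * real n + 2 \<le> real n ^ 3"
  proof -
    have "2 * n + 2 \<le> n * (2 * 2)" using n by simp
    also have "\<dots> \<le> n * (n * n)" using n by (intro mult_le_mono) auto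
    finally have "real (2 * n + 2) \<le> real (n * (n * n))" by (rule of_nat_mono)
    then show ?thesis by (simp add: power3_eq_cube)
  qed
  then have "ln (2 * real n + 2) \<le> ln (real n ^ 3)" using n by (intro ln_mono) auto
  also have "\<dots> = 3 * ln (real n)" using n by (simp add: ln_realpow)
  finally have l: "ln (2 * real n + 2) ^ 4 \<le> (3 * ln (real n)) ^ 4" by (intro power_mono) auto
  have "(real n)\<^sup>2 / (243 * ln (real n) ^ 4) = real n ^ 3 / ((3 * real n) * (3 * ln (real n)) ^ 4)"
    using n lnn by (simp add: power_mult_distrib power2_eq_square power3_eq_cube field_simps)
  also have "\<dots> \<le> real n ^ 3 / ((2 * real n + 2) * ln (2 * real n + 2) ^ 4)"
    using n l by (intro divide_left_mono mult_mono mult_pos_pos zero_less_power ln_gt_zero) auto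
  also have "\<dots> = real n * (real n * log_coeff (2 * n))\<^sup>2"
    by (simp only: power_mult_distrib log_coeff_square) (simp add: power2_eq_square power3_eq_cube)
  finally show ?thesis .
qed

text \<open>A ratio above \<open>1 / 3\<close> from some point on means growth of at most \<open>3\<^sup>m\<close> along the powers of two, whereas
  the lower bound is of order \<open>4\<^sup>m / m\<^sup>4\<close> there.\<close>

lemma dyadic_ratio_not_half:
  fixes v :: "nat \<Rightarrow> real"
  assumes c: "c > 0" and lower: "\<And>n. 2 \<le> n \<Longrightarrow> c * (real n)\<^sup>2 / ln (real n) ^ 4 \<le> v n"
  shows "\<not> (\<lambda>m. v (2 ^ m) / v (2 ^ Suc m)) \<longlonglongrightarrow> 1 / 2"
proof
  assume "(\<lambda>m. v (2 ^ m) / v (2 ^ Suc m)) \<longlonglongrightarrow> 1 / 2"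
  then have "\<forall>\<^sub>F m in sequentially. 1 / 3 < v (2 ^ m) / v (2 ^ Suc m)"
    by (rule order_tendstoD) simp
  then obtain m0 where m0: "\<And>m. m \<ge> m0 \<Longrightarrow> 1 / 3 < v (2 ^ m) / v (2 ^ Suc m)"
    by (auto simp: eventually_sequentially)
  have low: "c * 4 ^ m / (real m * ln 2) ^ 4 \<le> v (2 ^ m)" if "m \<ge> 1" for m
  proof -
    have "(2::nat) ^ 1 \<le> 2 ^ m" using that by (intro power_increasing) auto
    then have "c * (real (2 ^ m))\<^sup>2 / ln (real (2 ^ m)) ^ 4 \<le> v (2 ^ m)" by (intro lower) simp
    moreover have "(real (2 ^ m))\<^sup>2 = 4 ^ m" by (simp add: power_mult[symmetric] mult.commute[of m 2]) (simp add: power_mult)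
    ultimately show ?thesis by (simp add: ln_realpow)
  qed
  have pos: "0 < v (2 ^ m)" if "m \<ge> 1" for m
    using c that by (intro less_le_trans[OF _ low[OF that]] divide_pos_pos) auto
  define n0 where "n0 = Suc m0"
  have step: "v (2 ^ Suc m) \<le> 3 * v (2 ^ m)" if "m \<ge> n0" for m
    using m0[of m] pos[of "Suc m"] that by (simp add: n0_def field_simps)
  define C where "C = v (2 ^ n0) / 3 ^ n0"
  have up: "v (2 ^ m) \<le> C * 3 ^ m" if "m \<ge> n0" for m
    using that
  proof (induction m rule: dec_induct)
    case (step m)
    then show ?case using \<open>\<And>m. m \<ge> n0 \<Longrightarrow> v (2 ^ Suc m) \<le> 3 * v (2 ^ m)\<close>[of m] by simp
  qed (simp add: C_def)
  have C: "0 < C" using pos[of n0] by (simp add: C_def n0_def)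
  \<comment> \<open>Any \<open>x > 1\<close> with \<open>x\<^sup>4 \<le> 4 / 3\<close> serves: \<open>m\<^sup>4 (3/4)\<^sup>m\<close> is then at most \<open>(m / x\<^sup>m)\<^sup>4\<close>, which tends to \<open>0\<close>.\<close>
  define x where "x = (21 / 20 :: real)"
  have lim: "(\<lambda>m. C * (real m / x ^ m) ^ 4) \<longlonglongrightarrow> C * 0 ^ 4"
    by (intro tendsto_intros lim_n_over_pown) (simp add: x_def)
  have "c / ln 2 ^ 4 \<le> C * (real m / x ^ m) ^ 4" if "m \<ge> n0" for m
  proof -
    have m: "m \<ge> 1" using that by (simp add: n0_def)
    have "c * 4 ^ m / (real m * ln 2) ^ 4 \<le> C * 3 ^ m" using low[OF m] up[OF that] by linarith
    then have "c / ln 2 ^ 4 \<le> C * (real m ^ 4 * (3 ^ m / 4 ^ m))"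
      using m by (simp add: power_mult_distrib field_simps)
    also have "(3::real) ^ m / 4 ^ m = (3 / 4) ^ m" by (simp add: power_divide)
    also have "\<dots> \<le> (1 / x ^ 4) ^ m" by (intro power_mono) (simp_all add: x_def power4_eq_xxxx)
    also have "(1 / x ^ 4) ^ m = 1 / (x ^ m) ^ 4" by (simp add: power_divide flip: power_mult) (simp add: mult.commute)
    finally show ?thesis using C by (simp add: power_divide mult_left_mono)
  qed
  then have "c / ln 2 ^ 4 \<le> C * 0 ^ 4" by (intro LIMSEQ_le_const[OF lim]) blast
  moreover have "0 < c / ln 2 ^ 4" using c by simp
  ultimately show False by simp
qed

section \<open>Linear processes driven by Gaussian noise\<close>

abbreviation "noise \<equiv> PiM (UNIV :: int set) (\<lambda>_. std_normal_distribution)"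

interpretation noise: full_product_prob_space "\<lambda>_ :: int. std_normal_distribution"
proof -
  interpret N: prob_space std_normal_distribution by (rule prob_space_normal_density) simp
  show "full_product_prob_space (\<lambda>_ :: int. std_normal_distribution)"
    by unfold_locales simp
qed

lemma prob_space_noise: "prob_space noise"
  by (rule noise.P.prob_space_axioms)

lemma prob_space_std_normal: "prob_space std_normal_distribution"
  by (rule prob_space_normal_density) simp

lemma measurable_coordinate [measurable]: "(\<lambda>\<omega>. \<omega> i) \<in> borel_measurable noise"
proof -
  have "(\<lambda>\<omega>. \<omega> i) \<in> measurable noise std_normal_distribution" by (rule measurable_component_singleton) simp
  then show ?thesis by (simp cong: measurable_cong_sets)
qed

lemma distr_coordinate: "distr noise borel (\<lambda>\<omega>. \<omega> i) = std_normal_distribution"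
proof -
  have "distr noise borel (\<lambda>\<omega>. \<omega> i) = distr noise std_normal_distribution (\<lambda>\<omega>. \<omega> i)"
    by (intro distr_cong) auto
  also have "\<dots> = std_normal_distribution" by (rule distr_PiM_component) (auto intro: prob_space_std_normal)
  finally show ?thesis .
qed

lemma distributed_coordinate: "distributed noise lborel (\<lambda>\<omega>. \<omega> i) std_normal_density"
proof -
  have "distr noise lborel (\<lambda>\<omega>. \<omega> i) = distr noise borel (\<lambda>\<omega>. \<omega> i)" by (intro distr_cong) auto
  then show ?thesis unfolding distributed_def by (simp add: distr_coordinate)
qed

lemma indep_vars_coordinates:
  fixes f :: "'j \<Rightarrow> int"
  assumes "inj f"
  shows "noise.P.indep_vars (\<lambda>_. borel) (\<lambda>j \<omega>. \<omega> (f j)) UNIV"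
proof -
  have s: "sets (PiM UNIV (\<lambda>_::'j. borel :: real measure)) = sets (PiM UNIV (\<lambda>_::'j. std_normal_distribution))"
    by (intro sets_PiM_cong) auto
  have "distr noise (PiM UNIV (\<lambda>_::'j. borel)) (\<lambda>\<omega>. \<lambda>j\<in>UNIV. \<omega> (f j))
      = distr noise (PiM UNIV (\<lambda>_::'j. std_normal_distribution)) (\<lambda>\<omega>. \<lambda>j\<in>UNIV. \<omega> (f j))"
    using s by (intro distr_cong) auto
  also have "\<dots> = PiM UNIV (\<lambda>_::'j. std_normal_distribution)"
    using assms by (intro distr_PiM_reindex[where M = "\<lambda>_. std_normal_distribution"]) (auto intro: prob_space_std_normal)
  finally show ?thesis
    by (subst noise.P.indep_vars_iff_distr_eq_PiM) (auto simp: distr_coordinate)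
qed

lemma centred_gaussian_coordinate: "centred_gaussian noise (c\<^sup>2) (\<lambda>\<omega>. c * \<omega> i)"
  using noise.P.centred_gaussian_sum[OF noise.P.indep_vars_subset[OF indep_vars_coordinates[of "\<lambda>i. i"]], of "{i}" "\<lambda>_. c"]
  by (auto simp: distributed_coordinate)

lemma coordinate_integrable: "integrable noise (\<lambda>\<omega>. \<omega> i)"
  and coordinate_mean: "noise.P.expectation (\<lambda>\<omega>. \<omega> i) = 0"
  using noise.P.centred_gaussian_moments(1,2)[OF centred_gaussian_coordinate[of 1 i]] by simp_all

text \<open>Stationarity of a linear process is the invariance of the noise under this map.\<close>

definition shift :: "int \<Rightarrow> (int \<Rightarrow> real) \<Rightarrow> int \<Rightarrow> real" where
  "shift h \<omega> = (\<lambda>i. \<omega> (i + h))"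

lemma measurable_shift [measurable]: "shift h \<in> measurable noise noise"
  unfolding shift_def
  by (rule measurable_PiM_single') (auto intro: measurable_component_singleton)

lemma distr_shift: "distr noise noise (shift h) = noise"
proof -
  have "distr noise noise (\<lambda>\<omega>. \<lambda>i\<in>UNIV. \<omega> (i + h)) = noise"
    using distr_PiM_reindex[of UNIV "\<lambda>_. std_normal_distribution" "\<lambda>i. i + h" "UNIV :: int set"]
    by (auto intro: prob_space_std_normal simp: inj_on_def)
  then show ?thesis by (simp add: shift_def[abs_def] restrict_UNIV)
qed

definition linear_process :: "(nat \<Rightarrow> real) \<Rightarrow> int \<Rightarrow> (int \<Rightarrow> real) \<Rightarrow> real" where
  "linear_process c k \<omega> = (\<Sum>i. c i * \<omega> (k - int i))"

lemma measurable_linear_process [measurable]: "linear_process c k \<in> borel_measurable noise"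
  unfolding linear_process_def[abs_def] by measurable

lemma AE_summable_linear_process:
  assumes c: "summable (\<lambda>i. (c i)\<^sup>2)"
  shows "AE \<omega> in noise. summable (\<lambda>i. c i * \<omega> (k - int i))"
proof (rule noise.P.kolmogorov_series)
  note m = noise.P.centred_gaussian_moments[OF centred_gaussian_coordinate]
  show "noise.P.expectation (\<lambda>\<omega>. c i * \<omega> (k - int i)) = 0" for i by (rule m)
  show "integrable noise (\<lambda>\<omega>. (c i * \<omega> (k - int i))\<^sup>2)" for i by (rule m)
  show "summable (\<lambda>i. noise.P.expectation (\<lambda>\<omega>. (c i * \<omega> (k - int i))\<^sup>2))" unfolding m by (rule c)
  have "noise.P.indep_vars (\<lambda>_. borel) (\<lambda>i \<omega>. \<omega> (k - int i)) UNIV"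
    by (rule indep_vars_coordinates) (auto simp: inj_def)
  then show "noise.P.indep_vars (\<lambda>_. borel) (\<lambda>i \<omega>. c i * \<omega> (k - int i)) UNIV"
    by (rule noise.P.indep_vars_compose2) auto
qed

text \<open>Collecting the truncated series by the coordinate of the noise that they use gives a finite sum of
  independent Gaussian variables with coefficients \<open>b N m\<close>, and the class of centred Gaussian variables is
  closed under almost sure limits. The lower bound on the variance of the partial sums uses the
  explicit approximation of \<open>w\<close>.\<close>

lemma linear_process_combination:
  fixes a :: "int \<Rightarrow> real"
  assumes c: "summable (\<lambda>i. (c i)\<^sup>2)" and J: "finite J"
  defines "K \<equiv> \<lambda>N. (\<lambda>(j, i). j - int i) ` (J \<times> {..<N})"
    and "b \<equiv> \<lambda>N m. \<Sum>(j, i) \<in> {p \<in> J \<times> {..<N}. (case p of (j, i) \<Rightarrow> j - int i) = m}. a j * c i"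
  shows "\<exists>w. (\<lambda>N. \<Sum>m\<in>K N. (b N m)\<^sup>2) \<longlonglongrightarrow> w \<and> centred_gaussian noise w (\<lambda>\<omega>. \<Sum>j\<in>J. a j * linear_process c j \<omega>)"
proof (rule noise.P.centred_gaussian_AE_limit)
  show "centred_gaussian noise (\<Sum>m\<in>K N. (b N m)\<^sup>2) (\<lambda>\<omega>. \<Sum>m\<in>K N. b N m * \<omega> m)" for N
  proof (rule noise.P.centred_gaussian_sum)
    show "noise.P.indep_vars (\<lambda>_. borel) (\<lambda>i \<omega>. \<omega> i) (K N)"
      by (rule noise.P.indep_vars_subset[OF indep_vars_coordinates[of "\<lambda>i. i"]]) auto
  qed (use J in \<open>auto simp: K_def distributed_coordinate\<close>)
  show "(\<lambda>\<omega>. \<Sum>j\<in>J. a j * linear_process c j \<omega>) \<in> borel_measurable noise" by measurable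
  have eq: "(\<Sum>m\<in>K N. b N m * \<omega> m) = (\<Sum>j\<in>J. a j * (\<Sum>i<N. c i * \<omega> (j - int i)))" for N \<omega>
  proof -
    let ?S = "J \<times> {..<N}" and ?g = "\<lambda>(j, i). j - int i"
    have "(\<Sum>j\<in>J. a j * (\<Sum>i<N. c i * \<omega> (j - int i))) = (\<Sum>p\<in>?S. (case p of (j, i) \<Rightarrow> a j * c i * \<omega> (j - int i)))"
      by (simp add: sum_distrib_left sum.cartesian_product mult.assoc)
    also have "\<dots> = (\<Sum>m\<in>?g ` ?S. \<Sum>p\<in>{p \<in> ?S. ?g p = m}. (case p of (j, i) \<Rightarrow> a j * c i * \<omega> (j - int i)))"
      using J by (intro sum.image_gen) auto
    also have "\<dots> = (\<Sum>m\<in>K N. b N m * \<omega> m)"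
      unfolding K_def b_def sum_distrib_right by (intro sum.cong) auto
    finally show ?thesis by simp
  qed
  have "AE \<omega> in noise. \<forall>j. summable (\<lambda>i. c i * \<omega> (j - int i))"
    unfolding AE_all_countable by (intro allI AE_summable_linear_process c)
  then show "AE \<omega> in noise. (\<lambda>N. \<Sum>m\<in>K N. b N m * \<omega> m) \<longlonglongrightarrow> (\<Sum>j\<in>J. a j * linear_process c j \<omega>)"
  proof eventually_elim
    case (elim \<omega>)
    show ?case unfolding eq linear_process_def
      by (intro tendsto_intros summable_LIMSEQ) (use elim in auto)
  qed
qed

lemma gaussian_linear_process:
  assumes c: "summable (\<lambda>i. (c i)\<^sup>2)"
  shows "gaussian_process noise (linear_process c)"
  unfolding gaussian_process_def
proof (intro allI impI)
  fix J :: "int set" and a assume "finite J"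
  from linear_process_combination[OF c this, of a]
  show "normally_distributed noise (\<lambda>\<omega>. \<Sum>j\<in>J. a j * linear_process c j \<omega>)"
    by (blast intro: noise.P.centred_gaussian_normally_distributed)
qed

lemma centred_gaussian_linear_process:
  assumes c: "summable (\<lambda>i. (c i)\<^sup>2)"
  shows "centred_gaussian noise (\<Sum>i. (c i)\<^sup>2) (linear_process c k)"
proof -
  have "\<exists>w. (\<lambda>n. \<Sum>i<n. (c i)\<^sup>2) \<longlonglongrightarrow> w \<and> centred_gaussian noise w (linear_process c k)"
  proof (rule noise.P.centred_gaussian_AE_limit)
    show "centred_gaussian noise (\<Sum>i<n. (c i)\<^sup>2) (\<lambda>\<omega>. \<Sum>i<n. c i * \<omega> (k - int i))" for n
    proof (rule noise.P.centred_gaussian_sum)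
      show "noise.P.indep_vars (\<lambda>_. borel) (\<lambda>i \<omega>. \<omega> (k - int i)) {..<n}"
        by (rule noise.P.indep_vars_subset[OF indep_vars_coordinates]) (auto simp: inj_def)
    qed (auto simp: distributed_coordinate)
    show "AE \<omega> in noise. (\<lambda>n. \<Sum>i<n. c i * \<omega> (k - int i)) \<longlonglongrightarrow> linear_process c k \<omega>"
      using AE_summable_linear_process[OF c, of k]
      by eventually_elim (simp add: linear_process_def summable_LIMSEQ)
  qed measurable
  then show ?thesis using LIMSEQ_unique[OF summable_LIMSEQ[OF c]] by blast
qed

lemma stationary_linear_process: "strictly_stationary noise (linear_process c)"
  unfolding strictly_stationary_def
proof
  fix h
  let ?X = "\<lambda>\<omega> k. linear_process c k \<omega>" and ?B = "PiM UNIV (\<lambda>_::int. borel :: real measure)"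
  have [measurable]: "?X \<in> measurable noise ?B"
    by (rule measurable_PiM_single') auto
  have "distr noise ?B (\<lambda>\<omega> k. linear_process c (k + h) \<omega>) = distr noise ?B (?X \<circ> shift h)"
    by (simp add: linear_process_def shift_def comp_def algebra_simps)
  also have "\<dots> = distr (distr noise noise (shift h)) ?B ?X"
    by (rule distr_distr[symmetric]) measurable
  finally show "distr noise ?B (\<lambda>\<omega> k. linear_process c (k + h) \<omega>) = distr noise ?B ?X"
    by (simp add: distr_shift)
qed

text \<open>With nonnegative coefficients the process is a nondecreasing function of the noise on the event that
  all the series converge. Changing one coordinate of the noise changes at most one term of each
  series, so this event is stable in the sense that the Harris inequality requires.\<close>

lemma positively_associated_linear_process:
  assumes c: "summable (\<lambda>i. (c i)\<^sup>2)" and nonneg: "\<And>i. 0 \<le> c i"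
  shows "positively_associated noise (linear_process c)"
  unfolding positively_associated_def Let_def
proof (intro allI impI)
  fix J :: "int set" and f g :: "(int \<Rightarrow> real) \<Rightarrow> real"
  let ?X = "\<lambda>\<omega>. \<lambda>j\<in>J. linear_process c j \<omega>"
  define \<Omega> where "\<Omega> = {\<omega>. \<forall>k. summable (\<lambda>i. c i * \<omega> (k - int i))}"
  assume f: "mono_on (J \<rightarrow>\<^sub>E UNIV) f" "integrable noise (\<lambda>\<omega>. f (?X \<omega>))"
    and g: "mono_on (J \<rightarrow>\<^sub>E UNIV) g" "integrable noise (\<lambda>\<omega>. g (?X \<omega>))"
    and fg: "integrable noise (\<lambda>\<omega>. f (?X \<omega>) * g (?X \<omega>))"
  have upd: "\<xi>(m := y) \<in> \<Omega>" if "\<xi> \<in> \<Omega>" for \<xi> m y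
    unfolding \<Omega>_def
  proof (intro CollectI allI)
    fix k
    have "\<forall>\<^sub>F i in sequentially. c i * (\<xi>(m := y)) (k - int i) = c i * \<xi> (k - int i)"
      using eventually_gt_at_top[of "nat (k - m)"]
      by eventually_elim auto
    moreover have "summable (\<lambda>i. c i * \<xi> (k - int i))" using that by (simp add: \<Omega>_def)
    ultimately show "summable (\<lambda>i. c i * (\<xi>(m := y)) (k - int i))"
      by (rule summable_cong[THEN iffD2])
  qed
  have ae: "AE \<omega> in noise. \<omega> \<in> \<Omega>"
    unfolding \<Omega>_def mem_Collect_eq AE_all_countable by (intro allI AE_summable_linear_process c)
  have X: "?X \<omega> \<le> ?X \<omega>'" if "\<omega> \<in> \<Omega>" "\<omega>' \<in> \<Omega>" "\<omega> \<le> \<omega>'" for \<omega> \<omega>'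
    using that nonneg unfolding linear_process_def \<Omega>_def
    by (auto simp: le_fun_def intro!: suminf_le mult_left_mono)
  have mono: "mono_on \<Omega> (\<lambda>\<omega>. h (?X \<omega>))" if "mono_on (J \<rightarrow>\<^sub>E UNIV) h" for h :: "(int \<Rightarrow> real) \<Rightarrow> real"
    by (intro mono_onI mono_onD[OF that] X) auto
  show "0 \<le> cov noise (\<lambda>\<omega>. f (?X \<omega>)) (\<lambda>\<omega>. g (?X \<omega>))"
    using noise.harris_inequality[OF f(2) mono[OF f(1)] g(2) mono[OF g(1)] fg upd ae]
    unfolding cov_def by simp
qed

lemma linear_process_diff_AE:
  assumes c: "summable (\<lambda>i. (c i)\<^sup>2)" and d: "summable (\<lambda>i. (d i)\<^sup>2)"
  shows "AE \<omega> in noise. linear_process c k \<omega> - linear_process d k \<omega> = linear_process (\<lambda>i. c i - d i) k \<omega>"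
  using AE_summable_linear_process[OF c, of k] AE_summable_linear_process[OF d, of k]
  by eventually_elim (simp add: linear_process_def suminf_diff algebra_simps)

section \<open>Conditioning on part of the noise\<close>

definition observed :: "int set \<Rightarrow> (int \<Rightarrow> real) measure" where
  "observed I = vimage_algebra UNIV (\<lambda>\<omega>. restrict \<omega> I) (PiM I (\<lambda>_. borel))"

lemma space_observed [simp]: "space (observed I) = UNIV"
  by (simp add: observed_def)

lemma measurable_restrict_observed: "(\<lambda>\<omega>. restrict \<omega> I) \<in> measurable (observed I) (PiM I (\<lambda>_. borel))"
  unfolding observed_def by (rule measurable_vimage_algebra1) (auto simp: space_PiM)

lemma measurable_coordinate_observed: "i \<in> I \<Longrightarrow> (\<lambda>\<omega>. \<omega> i) \<in> borel_measurable (observed I)"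
  using measurable_compose[OF measurable_restrict_observed measurable_component_singleton, of i I] by simp

lemma sets_observed: "sets (observed I) = {(\<lambda>\<omega>. restrict \<omega> I) -` A | A. A \<in> sets (PiM I (\<lambda>_. borel))}"
  unfolding observed_def by (subst sets_vimage_algebra2) (auto simp: space_PiM)

lemma subalgebra_observed: "subalgebra noise (observed I)"
proof -
  have "(\<lambda>\<omega>. restrict \<omega> I) \<in> measurable noise (PiM I (\<lambda>_. borel))"
    by (rule measurable_restrict) (rule measurable_coordinate)
  from measurable_sets[OF this]
  have "(\<lambda>\<omega>. restrict \<omega> I) -` A \<in> sets noise" if "A \<in> sets (PiM I (\<lambda>_. borel))" for A
    using that by simp
  then show ?thesis by (auto simp: subalgebra_def sets_observed)
qed

lemma sets_observed_mono:
  assumes "I \<subseteq> J"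
  shows "sets (observed I) \<subseteq> sets (observed J)"
proof
  fix B assume "B \<in> sets (observed I)"
  then obtain A where A: "A \<in> sets (PiM I (\<lambda>_. borel))" "B = (\<lambda>\<omega>. restrict \<omega> I) -` A" by (auto simp: sets_observed)
  have "(\<lambda>\<omega>. restrict \<omega> I) \<in> measurable (observed J) (PiM I (\<lambda>_. borel))"
    using assms by (intro measurable_restrict measurable_coordinate_observed) auto
  from measurable_sets[OF this A(1)] show "B \<in> sets (observed J)" using A(2) by simp
qed

lemma measurable_linear_process_observed:
  assumes "\<And>i. k - int i \<notin> I \<Longrightarrow> c i = 0"
  shows "linear_process c k \<in> borel_measurable (observed I)"
proof -
  have "(\<lambda>\<omega>. c i * \<omega> (k - int i)) \<in> borel_measurable (observed I)" for i
    using assms[of i] measurable_coordinate_observed[of "k - int i" I] by (cases "k - int i \<in> I") auto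
  then show ?thesis unfolding linear_process_def[abs_def] by (rule borel_measurable_suminf)
qed

lemma integral_unobserved_coordinate:
  assumes A: "A \<in> sets (observed I)" and "i \<notin> I"
  shows "noise.P.expectation (\<lambda>\<omega>. indicator A \<omega> * \<omega> i) = 0"
proof -
  obtain B where B: "B \<in> sets (PiM I (\<lambda>_. borel))" "A = (\<lambda>\<omega>. restrict \<omega> I) -` B"
    using A by (auto simp: sets_observed)
  have "noise.P.indep_var (PiM I (\<lambda>_. borel)) (\<lambda>\<omega>. \<lambda>j\<in>I. \<omega> j) (PiM {i} (\<lambda>_. borel)) (\<lambda>\<omega>. \<lambda>j\<in>{i}. \<omega> j)"
    using \<open>i \<notin> I\<close> by (intro noise.P.indep_var_restrict[OF indep_vars_coordinates[of "\<lambda>i. i"]]) auto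
  from noise.P.indep_var_compose[OF this, of "indicator B" borel "\<lambda>x. x i" borel]
  have ind: "noise.P.indep_var borel (indicator B \<circ> (\<lambda>\<omega>. restrict \<omega> I) :: _ \<Rightarrow> real) borel ((\<lambda>x. x i) \<circ> (\<lambda>\<omega>. restrict \<omega> {i}))"
    using B(1) by (simp add: measurable_component_singleton)
  have eq: "indicator B \<circ> (\<lambda>\<omega>. restrict \<omega> I) = (indicator A :: _ \<Rightarrow> real)" "(\<lambda>x. x i) \<circ> (\<lambda>\<omega>. restrict \<omega> {i}) = (\<lambda>\<omega>. \<omega> i :: real)"
    using B(2) by (auto simp: fun_eq_iff indicator_def)
  have "A \<in> sets noise" using A subalgebra_observed[of I] by (auto simp: subalgebra_def)
  show ?thesis
    using noise.P.indep_var_lebesgue_integral[OF ind[unfolded eq]] coordinate_integrable coordinate_mean \<open>A \<in> sets noise\<close>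
    by (simp add: noise.P.emeasure_eq_measure)
qed

text \<open>For finitely many terms this is independence. The remainder of the series is centred Gaussian with
  the tail of \<open>\<Sum> c\<^sub>i\<^sup>2\<close> as its variance, so its \<open>L\<^sup>1\<close> norm tends to \<open>0\<close>.\<close>

lemma integral_unobserved_linear_process:
  assumes A: "A \<in> sets (observed I)" and c: "summable (\<lambda>i. (c i)\<^sup>2)" and unobs: "\<And>i. k - int i \<in> I \<Longrightarrow> c i = 0"
  shows "noise.P.expectation (\<lambda>\<omega>. indicator A \<omega> * linear_process c k \<omega>) = 0"
proof -
  define C where "C = (\<integral>x. \<bar>x\<bar> \<partial>std_normal_distribution)"
  define E where "E = noise.P.expectation (\<lambda>\<omega>. indicator A \<omega> * linear_process c k \<omega>)"
  have A' [measurable]: "A \<in> sets noise" using A subalgebra_observed[of I] by (auto simp: subalgebra_def)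
  have ind_int: "integrable noise (\<lambda>\<omega>. indicator A \<omega> * h \<omega>)" if "integrable noise h" for h :: "_ \<Rightarrow> real"
    using integrable_mult_indicator[OF A' that] by simp
  have bound: "\<bar>E\<bar> \<le> sqrt (\<Sum>i. (c (i + n))\<^sup>2) * C" for n
  proof -
    define d where "d i = (if i < n then 0 else c i)" for i
    have d: "summable (\<lambda>i. (d i)\<^sup>2)"
      using c by (rule summable_comparison_test'[where N = 0]) (auto simp: d_def)
    have "(\<Sum>i. (d i)\<^sup>2) = (\<Sum>i. (d (i + n))\<^sup>2) + (\<Sum>i<n. (d i)\<^sup>2)"
      using d by (rule suminf_split_initial_segment)
    then have dn: "(\<Sum>i. (d i)\<^sup>2) = (\<Sum>i. (c (i + n))\<^sup>2)" by (simp add: d_def)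
    note gd = noise.P.centred_gaussian_moments[OF centred_gaussian_linear_process[OF d, of k]]
    have "E = noise.P.expectation (\<lambda>\<omega>. (\<Sum>i<n. c i * (indicator A \<omega> * \<omega> (k - int i))) + indicator A \<omega> * linear_process d k \<omega>)"
      unfolding E_def
    proof (rule integral_cong_AE)
      show "AE \<omega> in noise. indicator A \<omega> * linear_process c k \<omega>
          = (\<Sum>i<n. c i * (indicator A \<omega> * \<omega> (k - int i))) + indicator A \<omega> * linear_process d k \<omega>"
        using AE_summable_linear_process[OF c, of k] AE_summable_linear_process[OF d, of k]
      proof eventually_elim
        case (elim \<omega>)
        have "linear_process c k \<omega> = (\<Sum>i. c (i + n) * \<omega> (k - int (i + n))) + (\<Sum>i<n. c i * \<omega> (k - int i))"
          unfolding linear_process_def using elim(1) by (rule suminf_split_initial_segment)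
        moreover have "linear_process d k \<omega> = (\<Sum>i. d (i + n) * \<omega> (k - int (i + n))) + (\<Sum>i<n. d i * \<omega> (k - int i))"
          unfolding linear_process_def using elim(2) by (rule suminf_split_initial_segment)
        ultimately have "linear_process c k \<omega> = (\<Sum>i<n. c i * \<omega> (k - int i)) + linear_process d k \<omega>"
          by (simp add: d_def)
        then show ?case by (simp add: algebra_simps sum_distrib_left)
      qed
    qed measurable
    also have "\<dots> = noise.P.expectation (\<lambda>\<omega>. indicator A \<omega> * linear_process d k \<omega>)"
    proof (subst Bochner_Integration.integral_add)
      have "c i * noise.P.expectation (\<lambda>\<omega>. indicator A \<omega> * \<omega> (k - int i)) = 0" for i
        using unobs[of i] integral_unobserved_coordinate[OF A, of "k - int i"] by (cases "k - int i \<in> I") auto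
      moreover have "noise.P.expectation (\<lambda>\<omega>. \<Sum>i<n. c i * (indicator A \<omega> * \<omega> (k - int i)))
          = (\<Sum>i<n. c i * noise.P.expectation (\<lambda>\<omega>. indicator A \<omega> * \<omega> (k - int i)))"
        by (subst Bochner_Integration.integral_sum) (auto intro!: ind_int coordinate_integrable)
      ultimately have "noise.P.expectation (\<lambda>\<omega>. \<Sum>i<n. c i * (indicator A \<omega> * \<omega> (k - int i))) = 0"
        by (simp only: sum.neutral_const)
      then show "noise.P.expectation (\<lambda>\<omega>. \<Sum>i<n. c i * (indicator A \<omega> * \<omega> (k - int i)))
          + noise.P.expectation (\<lambda>\<omega>. indicator A \<omega> * linear_process d k \<omega>)
          = noise.P.expectation (\<lambda>\<omega>. indicator A \<omega> * linear_process d k \<omega>)" by simp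
    qed (auto intro!: Bochner_Integration.integrable_sum ind_int coordinate_integrable gd(1))
    finally have "\<bar>E\<bar> \<le> noise.P.expectation (\<lambda>\<omega>. \<bar>indicator A \<omega> * linear_process d k \<omega>\<bar>)"
      using integral_abs_bound by metis
    also have "\<dots> \<le> noise.P.expectation (\<lambda>\<omega>. \<bar>linear_process d k \<omega>\<bar>)"
      by (intro integral_mono integrable_abs ind_int gd(1)) (auto simp: indicator_def)
    also have "\<dots> = sqrt (\<Sum>i. (c (i + n))\<^sup>2) * C" unfolding gd(5) dn C_def ..
    finally show ?thesis .
  qed
  have "(\<lambda>n. sqrt (\<Sum>i. (c (i + n))\<^sup>2) * C) \<longlonglongrightarrow> sqrt 0 * C"
    by (intro tendsto_intros suminf_exist_split2[OF c])
  then have "\<bar>E\<bar> \<le> 0" using LIMSEQ_le_const[of _ "sqrt 0 * C" "\<bar>E\<bar>"] bound by auto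
  then show ?thesis by (simp add: E_def)
qed

lemma finite_measure_subalgebra_noise: "subalgebra noise F \<Longrightarrow> finite_measure_subalgebra noise F"
  by (simp add: finite_measure_subalgebra_def finite_measure_subalgebra_axioms_def noise.P.finite_measure_axioms)

text \<open>The terms with observed innovations form a measurable function, and the other terms integrate to \<open>0\<close>
  over every observed event.\<close>

lemma cond_exp_linear_process:
  assumes c: "summable (\<lambda>i. (c i)\<^sup>2)"
  shows "AE \<omega> in noise. real_cond_exp noise (observed I) (linear_process c k) \<omega>
    = linear_process (\<lambda>i. if k - int i \<in> I then c i else 0) k \<omega>"
proof -
  interpret F: finite_measure_subalgebra noise "observed I"
    by (rule finite_measure_subalgebra_noise[OF subalgebra_observed])
  let ?p = "\<lambda>i. if k - int i \<in> I then c i else 0" and ?q = "\<lambda>i. if k - int i \<in> I then 0 else c i"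
  have p: "summable (\<lambda>i. (?p i)\<^sup>2)" and q: "summable (\<lambda>i. (?q i)\<^sup>2)"
    using c by (auto intro: summable_comparison_test'[where N = 0 and g = "\<lambda>i. (c i)\<^sup>2"])
  note ci = noise.P.centred_gaussian_moments(1)[OF centred_gaussian_linear_process]
  show ?thesis
  proof (rule F.real_cond_exp_charact)
    fix A assume A: "A \<in> sets (observed I)"
    have A' [measurable]: "A \<in> sets noise" using A subalgebra_observed[of I] by (auto simp: subalgebra_def)
    have ind_int: "integrable noise (\<lambda>\<omega>. indicator A \<omega> * h \<omega>)" if "integrable noise h" for h :: "_ \<Rightarrow> real"
      using integrable_mult_indicator[OF A' that] by simp
    have "(\<lambda>i. c i - ?p i) = ?q" by auto
    with linear_process_diff_AE[OF c p, of k]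
    have ae: "AE \<omega> in noise. linear_process c k \<omega> - linear_process ?p k \<omega> = linear_process ?q k \<omega>" by simp
    have "noise.P.expectation (\<lambda>\<omega>. indicator A \<omega> * linear_process c k \<omega>)
        - noise.P.expectation (\<lambda>\<omega>. indicator A \<omega> * linear_process ?p k \<omega>)
        = noise.P.expectation (\<lambda>\<omega>. indicator A \<omega> * linear_process c k \<omega> - indicator A \<omega> * linear_process ?p k \<omega>)"
      by (intro Bochner_Integration.integral_diff[symmetric] ind_int ci c p)
    also have "\<dots> = noise.P.expectation (\<lambda>\<omega>. indicator A \<omega> * linear_process ?q k \<omega>)"
    proof (rule integral_cong_AE)
      show "AE \<omega> in noise. indicator A \<omega> * linear_process c k \<omega> - indicator A \<omega> * linear_process ?p k \<omega>
          = indicator A \<omega> * linear_process ?q k \<omega>"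
        using ae by eventually_elim (simp add: right_diff_distrib[symmetric])
    qed measurable
    also have "\<dots> = 0" using A q by (rule integral_unobserved_linear_process) auto
    finally show "(\<integral>\<omega>\<in>A. linear_process c k \<omega> \<partial>noise) = (\<integral>\<omega>\<in>A. linear_process ?p k \<omega> \<partial>noise)"
      unfolding set_lebesgue_integral_def by simp
  next
    show "linear_process ?p k \<in> borel_measurable (observed I)"
      by (rule measurable_linear_process_observed) simp
  qed (rule ci[OF c] ci[OF p])+
qed

section \<open>Filtrations with sparse jumps\<close>

lemma sparse_tails:
  fixes c :: "nat \<Rightarrow> real"
  assumes c: "summable (\<lambda>i. (c i)\<^sup>2)"
  shows "\<exists>a :: nat \<Rightarrow> nat. strict_mono a \<and> (\<forall>l. (\<Sum>i. (c (i + a l))\<^sup>2) \<le> (1 / 4) ^ l)"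
proof -
  have "\<forall>l. \<exists>N. \<forall>m\<ge>N. (\<Sum>i. (c (i + m))\<^sup>2) \<le> (1 / 4) ^ l"
  proof
    fix l :: nat
    have "\<forall>\<^sub>F m in sequentially. (\<Sum>i. (c (i + m))\<^sup>2) < (1 / 4) ^ l"
      using suminf_exist_split2[OF c] by (rule order_tendstoD) simp
    then show "\<exists>N. \<forall>m\<ge>N. (\<Sum>i. (c (i + m))\<^sup>2) \<le> (1 / 4) ^ l"
      unfolding eventually_sequentially by (meson less_imp_le)
  qed
  then obtain N where N: "\<And>l m. m \<ge> N l \<Longrightarrow> (\<Sum>i. (c (i + m))\<^sup>2) \<le> (1 / 4) ^ l" by metis
  \<comment> \<open>The partial sums dominate \<open>N\<close>, and adding \<open>l\<close> makes them strictly increasing.\<close>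
  define a where "a l = (\<Sum>i\<le>l. N i) + l" for l
  have "strict_mono a" by (rule strict_mono_Suc_iff[THEN iffD2]) (simp add: a_def)
  moreover have "N l \<le> a l" for l
    using member_le_sum[of l "{..l}" N] by (simp add: a_def)
  ultimately show ?thesis using N by blast
qed

lemma restricted_tail_le:
  fixes c :: "nat \<Rightarrow> real"
  assumes c: "summable (\<lambda>i. (c i)\<^sup>2)" and P: "\<And>i. P i \<Longrightarrow> m \<le> i"
  shows "summable (\<lambda>i. (if P i then c i else 0)\<^sup>2)"
    and "(\<Sum>i. (if P i then c i else 0)\<^sup>2) \<le> (\<Sum>i. (c (i + m))\<^sup>2)"
proof -
  show s: "summable (\<lambda>i. (if P i then c i else 0)\<^sup>2)"
    using c by (rule summable_comparison_test'[where N = 0]) auto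
  have "(\<Sum>i. (if P i then c i else 0)\<^sup>2)
      = (\<Sum>i. (if P (i + m) then c (i + m) else 0)\<^sup>2) + (\<Sum>i<m. (if P i then c i else 0)\<^sup>2)"
    using s by (rule suminf_split_initial_segment)
  also have "(\<Sum>i<m. (if P i then c i else 0)\<^sup>2) = 0"
    using P by (intro sum.neutral) force
  also have "(\<Sum>i. (if P (i + m) then c (i + m) else 0)\<^sup>2) + 0 \<le> (\<Sum>i. (c (i + m))\<^sup>2)"
    using s c by (simp, intro suminf_le) (auto simp: summable_iff_shift[of "\<lambda>i. (if P i then c i else 0)\<^sup>2"] summable_iff_shift[of "\<lambda>i. (c i)\<^sup>2"])
  finally show "(\<Sum>i. (if P i then c i else 0)\<^sup>2) \<le> (\<Sum>i. (c (i + m))\<^sup>2)" .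
qed

text \<open>The indices of the innovations known at time \<open>j\<close>. For strictly increasing \<open>a\<close>, the smallest of the
  numbers \<open>- a l\<close> that are at least \<open>j\<close> is the binding constraint, and there is none for \<open>j > - a 0\<close>.\<close>

definition window :: "(nat \<Rightarrow> nat) \<Rightarrow> int \<Rightarrow> int set" where
  "window a j = {i. \<forall>l. j \<le> - int (a l) \<longrightarrow> i \<le> - int (a l)}"

lemma window_mono: "j \<le> j' \<Longrightarrow> window a j \<subseteq> window a j'"
  by (auto simp: window_def)

lemma past_in_window: "k - int i \<in> window a k"
  by (auto simp: window_def)

text \<open>The window is constant between the times \<open>- a l\<close> and jumps just after each of them.\<close>

lemma window_step:
  assumes "j \<notin> range (\<lambda>l. 1 - int (a l))"
  shows "window a j = window a (j - 1)"
proof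
  show "window a j \<subseteq> window a (j - 1)"
  proof
    fix i assume i: "i \<in> window a j"
    have "i \<le> - int (a l)" if "j - 1 \<le> - int (a l)" for l
    proof -
      have "j \<noteq> 1 - int (a l)" using assms by auto
      then show ?thesis using i that by (auto simp: window_def)
    qed
    then show "i \<in> window a (j - 1)" by (simp add: window_def)
  qed
qed (rule window_mono, simp)

lemma L2_norm_proj_diff:
  assumes c: "summable (\<lambda>i. (c i)\<^sup>2)" and W: "W (j - 1) \<subseteq> W j"
  shows "L2_norm noise (proj_diff noise (\<lambda>j. observed (W j)) j (linear_process c k))
    = sqrt (\<Sum>i. (if k - int i \<in> W j - W (j - 1) then c i else 0)\<^sup>2)"
proof -
  let ?p = "\<lambda>I i. if k - int i \<in> I then c i else 0"
  have p: "summable (\<lambda>i. (?p I i)\<^sup>2)" for I using restricted_tail_le(1)[OF c, of _ 0] by simp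
  have eq: "(\<lambda>i. ?p (W j) i - ?p (W (j - 1)) i) = ?p (W j - W (j - 1))"
    using W by (intro ext) auto
  have "AE \<omega> in noise. proj_diff noise (\<lambda>j. observed (W j)) j (linear_process c k) \<omega>
      = linear_process (?p (W j - W (j - 1))) k \<omega>"
    using cond_exp_linear_process[OF c, of "W j" k] cond_exp_linear_process[OF c, of "W (j - 1)" k]
      linear_process_diff_AE[OF p[of "W j"] p[of "W (j - 1)"], of k]
    unfolding eq proj_diff_def by eventually_elim simp
  then have "(\<integral>\<omega>. (proj_diff noise (\<lambda>j. observed (W j)) j (linear_process c k) \<omega>)\<^sup>2 \<partial>noise)
      = (\<integral>\<omega>. (linear_process (?p (W j - W (j - 1))) k \<omega>)\<^sup>2 \<partial>noise)"
    unfolding proj_diff_def by (intro integral_cong_AE) (auto simp: borel_measurable_cond_exp2)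
  also have "\<dots> = (\<Sum>i. (?p (W j - W (j - 1)) i)\<^sup>2)"
    by (rule noise.P.centred_gaussian_moments(4)[OF centred_gaussian_linear_process[OF p]])
  finally show ?thesis by (simp add: L2_norm_def)
qed

text \<open>Only the jumps at \<open>j = 1 - a l\<close> contribute. For \<open>k \<ge> 0\<close> and \<open>l > 0\<close> the innovations revealed there have
  index at most \<open>- a (l - 1)\<close>, so they carry coefficients of \<open>X\<^sub>k\<close> of index at least \<open>a (l - 1)\<close>, and the
  choice of \<open>a\<close> bounds the norm by \<open>2\<^sup>-\<^sup>(\<^sup>l\<^sup>-\<^sup>1\<^sup>)\<close>. The last jump, \<open>l = 0\<close>, is bounded by the norm of \<open>X\<^sub>k\<close>.\<close>

lemma summable_projections:
  assumes c: "summable (\<lambda>i. (c i)\<^sup>2)" and a: "strict_mono a"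
    and tails: "\<And>l. (\<Sum>i. (c (i + a l))\<^sup>2) \<le> (1 / 4) ^ l"
  shows "(SUP k\<in>{0::int..}. \<Sum>\<^sub>\<infinity>j\<in>(UNIV::int set).
    ennreal (L2_norm noise (proj_diff noise (\<lambda>j. observed (window a j)) j (linear_process c k)))) < \<infinity>"
proof -
  define B where "B l = (case l of 0 \<Rightarrow> sqrt (\<Sum>i. (c i)\<^sup>2) | Suc l \<Rightarrow> (1 / 2) ^ l)" for l
  have B: "summable B" unfolding summable_Suc_iff[of B, symmetric] by (simp add: B_def summable_geometric)
  have B0: "0 \<le> B l" for l using c by (auto simp: B_def suminf_nonneg split: nat.split)
  have "(\<Sum>\<^sub>\<infinity>j\<in>(UNIV::int set). ennreal (L2_norm noise (proj_diff noise (\<lambda>j. observed (window a j)) j (linear_process c k))))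
      \<le> ennreal (\<Sum>l. B l)" if k: "0 \<le> k" for k
  proof (rule infsum_le_finite_sums)
    let ?\<phi> = "\<lambda>l. 1 - int (a l)"
    define f where "f j = L2_norm noise (proj_diff noise (\<lambda>j. observed (window a j)) j (linear_process c k))" for j
    have f: "f j = sqrt (\<Sum>i. (if k - int i \<in> window a j - window a (j - 1) then c i else 0)\<^sup>2)" for j
      unfolding f_def using c by (intro L2_norm_proj_diff window_mono) auto
    have f0: "f j = 0" if "j \<notin> range ?\<phi>" for j
      unfolding f using window_step[OF that] by simp
    have fB: "f (?\<phi> l) \<le> B l" for l
    proof (cases l)
      case 0
      have "f (?\<phi> l) \<le> sqrt (\<Sum>i. (c (i + 0))\<^sup>2)"
        unfolding f by (intro real_sqrt_le_mono restricted_tail_le(2)[OF c]) simp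
      then show ?thesis using 0 by (simp add: B_def)
    next
      case (Suc l')
      have al: "a l' < a l" using a Suc by (simp add: strict_mono_def)
      have "f (?\<phi> l) \<le> sqrt (\<Sum>i. (c (i + a l'))\<^sup>2)"
        unfolding f
      proof (intro real_sqrt_le_mono restricted_tail_le(2)[OF c])
        fix i assume "k - int i \<in> window a (?\<phi> l) - window a (?\<phi> l - 1)"
        then have "?\<phi> l \<le> - int (a l') \<longrightarrow> k - int i \<le> - int (a l')" by (simp add: window_def)
        then show "a l' \<le> i" using al k by linarith
      qed
      also have "\<dots> \<le> sqrt ((1 / 4) ^ l')" by (intro real_sqrt_le_mono tails)
      also have "\<dots> = (1 / 2) ^ l'" by (simp add: real_sqrt_power real_sqrt_divide)
      finally show ?thesis using Suc by (simp add: B_def)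
    qed
    have inj: "inj ?\<phi>" using strict_mono_imp_inj_on[OF a] by (auto simp: inj_def)
    show "(\<lambda>j. ennreal (f j)) summable_on UNIV" by (rule nonneg_summable_on_complete) simp
    fix F :: "int set" assume F: "finite F"
    let ?L = "?\<phi> -` F"
    have L: "finite ?L" using F inj by (rule finite_vimageI)
    have "(\<Sum>j\<in>F. ennreal (f j)) = (\<Sum>j\<in>?\<phi> ` ?L. ennreal (f j))"
      using F f0 by (intro sum.mono_neutral_right) auto
    also have "\<dots> = (\<Sum>l\<in>?L. ennreal (f (?\<phi> l)))"
      using inj by (subst sum.reindex) (auto simp: inj_on_def inj_def)
    also have "\<dots> \<le> (\<Sum>l\<in>?L. ennreal (B l))" by (intro sum_mono ennreal_leI fB)
    also have "\<dots> = ennreal (\<Sum>l\<in>?L. B l)" using B0 by (intro sum_ennreal) auto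
    also have "\<dots> \<le> ennreal (\<Sum>l. B l)" using B B0 L by (intro ennreal_leI sum_le_suminf) auto
    finally show "(\<Sum>j\<in>F. ennreal (f j)) \<le> ennreal (\<Sum>l. B l)" .
  qed
  then have "(SUP k\<in>{0::int..}. \<Sum>\<^sub>\<infinity>j\<in>(UNIV::int set).
      ennreal (L2_norm noise (proj_diff noise (\<lambda>j. observed (window a j)) j (linear_process c k)))) \<le> ennreal (\<Sum>l. B l)"
    by (intro SUP_least) auto
  also have "\<dots> < \<infinity>" by simp
  finally show ?thesis .
qed

text \<open>On an event \<open>A\<close> of the remote past, \<open>X\<^sub>k\<close> has the same integral as its conditional expectation given \<open>F\<^sub>j\<close>,
  for every \<open>j\<close>. Along \<open>j = - a l\<close> this conditional expectation keeps only coefficients of large index, so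
  its \<open>L\<^sup>1\<close> norm tends to \<open>0\<close>.\<close>

lemma cond_exp_remote_past:
  assumes c: "summable (\<lambda>i. (c i)\<^sup>2)" and a: "strict_mono a"
  shows "AE \<omega> in noise. real_cond_exp noise (filtration_tail noise (\<lambda>j. observed (window a j))) (linear_process c k) \<omega> = 0"
proof -
  let ?F = "\<lambda>j. observed (window a j)"
  define C where "C = (\<integral>x. \<bar>x\<bar> \<partial>std_normal_distribution)"
  have C: "0 \<le> C" unfolding C_def by (rule Bochner_Integration.integral_nonneg) simp
  have tail_sets: "sets (filtration_tail noise ?F) \<subseteq> sets (?F j)" for j
  proof -
    have "sets (filtration_tail noise ?F) = sigma_sets UNIV (\<Inter>i. sets (?F i))"
      unfolding filtration_tail_def by (simp add: sets_measure_of)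
    also have "\<dots> \<subseteq> sets (?F j)"
      using sets.sigma_sets_subset[of "\<Inter>i. sets (?F i)" "?F j"] by auto
    finally show ?thesis .
  qed
  have sub: "subalgebra noise (filtration_tail noise ?F)"
    using tail_sets[of 0] subalgebra_observed[of "window a 0"]
    by (auto simp: subalgebra_def filtration_tail_def space_measure_of_conv)
  interpret T: finite_measure_subalgebra noise "filtration_tail noise ?F"
    by (rule finite_measure_subalgebra_noise[OF sub])
  note gauss = noise.P.centred_gaussian_moments[OF centred_gaussian_linear_process]
  show ?thesis
  proof (rule T.real_cond_exp_charact)
    fix A assume A: "A \<in> sets (filtration_tail noise ?F)"
    have A' [measurable]: "A \<in> sets noise" using A sub by (auto simp: subalgebra_def)
    define E where "E = (\<integral>\<omega>\<in>A. linear_process c k \<omega> \<partial>noise)"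
    have bound: "\<bar>E\<bar> \<le> sqrt (\<Sum>i. (c (i + n))\<^sup>2) * C" for n
    proof -
      \<comment> \<open>The shift by \<open>k\<close> ensures that the window at \<open>- a l\<close> leaves only coefficients of index at least \<open>n\<close>.\<close>
      define l where "l = n + nat \<bar>k\<bar>"
      define j where "j = - int (a l)"
      have al: "l \<le> a l" using strict_mono_imp_increasing[OF a] by simp
      interpret O: finite_measure_subalgebra noise "?F j"
        by (rule finite_measure_subalgebra_noise[OF subalgebra_observed])
      let ?p = "\<lambda>i. if k - int i \<in> window a j then c i else 0"
      have P: "n \<le> i" if "k - int i \<in> window a j" for i
      proof -
        have "k - int i \<le> - int (a l)" using that by (simp add: window_def j_def)
        then show ?thesis using al by (simp add: l_def)
      qed
      have p: "summable (\<lambda>i. (?p i)\<^sup>2)" using restricted_tail_le(1)[OF c P] .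
      have AF: "A \<in> sets (?F j)" using A tail_sets by auto
      have "E = (\<integral>\<omega>\<in>A. real_cond_exp noise (?F j) (linear_process c k) \<omega> \<partial>noise)"
        unfolding E_def using gauss(1)[OF c] AF by (rule O.real_cond_exp_intA)
      also have "\<dots> = (\<integral>\<omega>\<in>A. linear_process ?p k \<omega> \<partial>noise)"
        unfolding set_lebesgue_integral_def
      proof (rule integral_cong_AE)
        show "AE \<omega> in noise. indicator A \<omega> *\<^sub>R real_cond_exp noise (?F j) (linear_process c k) \<omega>
            = indicator A \<omega> *\<^sub>R linear_process ?p k \<omega>"
          using cond_exp_linear_process[OF c, of "window a j" k] by eventually_elim simp
      qed (auto simp: borel_measurable_cond_exp2)
      finally have "\<bar>E\<bar> \<le> noise.P.expectation (\<lambda>\<omega>. \<bar>indicator A \<omega> *\<^sub>R linear_process ?p k \<omega>\<bar>)"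
        unfolding set_lebesgue_integral_def using integral_abs_bound by metis
      also have "\<dots> \<le> noise.P.expectation (\<lambda>\<omega>. \<bar>linear_process ?p k \<omega>\<bar>)"
        by (intro integral_mono integrable_abs integrable_mult_indicator A' gauss(1)[OF p]) (auto simp: indicator_def)
      also have "\<dots> = sqrt (\<Sum>i. (?p i)\<^sup>2) * C" unfolding gauss(5)[OF p] C_def ..
      also have "\<dots> \<le> sqrt (\<Sum>i. (c (i + n))\<^sup>2) * C"
        using C by (intro mult_right_mono real_sqrt_le_mono restricted_tail_le(2)[OF c P])
      finally show ?thesis .
    qed
    have "(\<lambda>n. sqrt (\<Sum>i. (c (i + n))\<^sup>2) * C) \<longlonglongrightarrow> sqrt 0 * C"
      by (intro tendsto_intros suminf_exist_split2[OF c])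
    then have "\<bar>E\<bar> \<le> 0" using LIMSEQ_le_const[of _ "sqrt 0 * C" "\<bar>E\<bar>"] bound by auto
    then show "(\<integral>\<omega>\<in>A. linear_process c k \<omega> \<partial>noise) = (\<integral>\<omega>\<in>A. 0 \<partial>noise)"
      by (simp add: E_def set_lebesgue_integral_def)
  qed (use gauss(1)[OF c] in auto)
qed

section \<open>Variance of the partial sums\<close>

abbreviation partial_sum_variance :: "(nat \<Rightarrow> real) \<Rightarrow> nat \<Rightarrow> real" where
  "partial_sum_variance c n \<equiv> noise.P.variance (partial_sum (linear_process c) n)"

lemma
  assumes c: "summable (\<lambda>i. (c i)\<^sup>2)" and nonneg: "\<And>i. 0 \<le> c i" and anti: "\<And>i j. i \<le> j \<Longrightarrow> c j \<le> c i"
  shows centred_gaussian_partial_sum: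
      "centred_gaussian noise (partial_sum_variance c n) (partial_sum (linear_process c) n)"
    and partial_sum_variance_lower: "real n * (real n * c (2 * n))\<^sup>2 \<le> partial_sum_variance c n"
proof -
  let ?J = "int ` {1..n}"
  define K where "K N = (\<lambda>(j, i). j - int i) ` (?J \<times> {..<N})" for N
  define b where "b N m = (\<Sum>(j, i) \<in> {p \<in> ?J \<times> {..<N}. (case p of (j, i) \<Rightarrow> j - int i) = m}. 1 * c i)" for N m
  obtain w where w: "(\<lambda>N. \<Sum>m\<in>K N. (b N m)\<^sup>2) \<longlonglongrightarrow> w"
    and g: "centred_gaussian noise w (\<lambda>\<omega>. \<Sum>j\<in>?J. 1 * linear_process c j \<omega>)"
    using linear_process_combination[OF c, of ?J "\<lambda>_. 1"] unfolding K_def b_def by auto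
  have "(\<lambda>\<omega>. \<Sum>j\<in>?J. 1 * linear_process c j \<omega>) = partial_sum (linear_process c) n"
    by (simp add: fun_eq_iff partial_sum_def sum.reindex)
  then have g: "centred_gaussian noise w (partial_sum (linear_process c) n)" using g by simp
  then have wv: "partial_sum_variance c n = w" by (rule noise.P.centred_gaussian_variance)
  show "centred_gaussian noise (partial_sum_variance c n) (partial_sum (linear_process c) n)"
    using g unfolding wv .
  have "real n * (real n * c (2 * n))\<^sup>2 \<le> w"
  proof (rule LIMSEQ_le_const[OF w], intro exI[of _ "2 * n"] allI impI)
    fix N assume N: "2 * n \<le> N"
    \<comment> \<open>For \<open>- n < m \<le> 0\<close> the innovation \<open>m\<close> enters each of \<open>X\<^sub>1, \<dots>, X\<^sub>n\<close>, with a coefficient of index below \<open>2 n\<close>.\<close>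
    have b: "real n * c (2 * n) \<le> b N m" if m: "m \<in> {1 - int n..0}" for m
    proof -
      let ?S = "{p \<in> ?J \<times> {..<N}. (case p of (j, i) \<Rightarrow> j - int i) = m}"
      let ?h = "\<lambda>j. (j, nat (j - m))"
      have "real n * c (2 * n) = (\<Sum>j\<in>?J. c (2 * n))" by (simp add: card_image)
      also have "\<dots> \<le> (\<Sum>j\<in>?J. c (nat (j - m)))" using m by (intro sum_mono anti) auto
      also have "\<dots> = (\<Sum>(j, i)\<in>?h ` ?J. 1 * c i)" by (subst sum.reindex) (auto simp: inj_on_def)
      also have "\<dots> \<le> b N m"
        unfolding b_def
      proof (rule sum_mono2)
        show "finite ?S" by (rule finite_subset[of _ "?J \<times> {..<N}"]) auto
        show "?h ` ?J \<subseteq> ?S" using m N by auto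
      qed (auto simp: nonneg)
      finally show ?thesis .
    qed
    have "real n * (real n * c (2 * n))\<^sup>2 = (\<Sum>m\<in>{1 - int n..0}. (real n * c (2 * n))\<^sup>2)" by simp
    also have "\<dots> \<le> (\<Sum>m\<in>{1 - int n..0}. (b N m)\<^sup>2)"
      using b nonneg by (intro sum_mono power_mono) auto
    also have "\<dots> \<le> (\<Sum>m\<in>K N. (b N m)\<^sup>2)"
    proof (rule sum_mono2)
      show "finite (K N)" by (simp add: K_def)
      show "{1 - int n..0} \<subseteq> K N"
      proof
        fix m assume m: "m \<in> {1 - int n..0}"
        then have "m = (case (1, nat (1 - m)) of (j, i) \<Rightarrow> j - int i)" by simp
        moreover have "(1, nat (1 - m)) \<in> ?J \<times> {..<N}" using m N by (auto intro!: image_eqI[of _ _ 1])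
        ultimately show "m \<in> K N" unfolding K_def by (rule image_eqI)
      qed
    qed simp
    finally show "real n * (real n * c (2 * n))\<^sup>2 \<le> (\<Sum>m\<in>K N. (b N m)\<^sup>2)" .
  qed
  then show "real n * (real n * c (2 * n))\<^sup>2 \<le> partial_sum_variance c n" unfolding wv .
qed

section \<open>Weak convergence determines the variance ratio\<close>

lemma expectation_cos_normal:
  assumes "prob_space N" and "\<sigma> > 0" and W: "distributed N lborel W (normal_density 0 \<sigma>)"
  shows "(\<integral>\<omega>. cos (W \<omega>) \<partial>N) = exp (- \<sigma>\<^sup>2 / 2)"
proof -
  interpret N: prob_space N by fact
  have D: "distributed N lborel (\<lambda>\<omega>. (W \<omega> - 0) / \<sigma>) std_normal_density"
    using W \<open>\<sigma> > 0\<close> by (subst (asm) N.normal_standard_normal_convert) auto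
  have [measurable]: "(\<lambda>\<omega>. W \<omega> / \<sigma>) \<in> borel_measurable N"
    using distributed_measurable[OF D] by simp
  have "distr N borel (\<lambda>\<omega>. W \<omega> / \<sigma>) = distr N lborel (\<lambda>\<omega>. W \<omega> / \<sigma>)" by (intro distr_cong) auto
  also have "\<dots> = std_normal_distribution" using D by (simp add: distributed_def)
  finally have "centred_gaussian N 1 (\<lambda>\<omega>. W \<omega> / \<sigma>)"
    by (intro N.centred_gaussianI_char) (auto simp: char_std_normal_distribution)
  from N.centred_gaussian_cos[OF N.centred_gaussian_scale[OF this, of \<sigma>]]
  show ?thesis using \<open>\<sigma> > 0\<close> by simp
qed

lemma continuous_map_cos_midpoint: "continuous_map D01_topology euclideanreal (\<lambda>x. cos (x (1 / 2)))"
proof -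
  interpret Metric_space D01 sup_dist by (rule Metric_space_D01)
  have "openin mtopology {x \<in> D01. cos (x (1 / 2)) \<in> U}" if U: "open U" for U
    unfolding openin_mtopology
  proof (intro conjI allI impI)
    fix x assume "x \<in> {x \<in> D01. cos (x (1 / 2)) \<in> U}"
    then have x: "x \<in> D01" "cos (x (1 / 2)) \<in> U" by auto
    have "open (cos -` U :: real set)" using U by (intro open_vimage continuous_intros)
    then obtain r where r: "r > 0" "\<And>y. dist y (x (1 / 2)) < r \<Longrightarrow> cos y \<in> U"
      using x(2) unfolding open_dist by auto
    have "mball x r \<subseteq> {x \<in> D01. cos (x (1 / 2)) \<in> U}"
    proof
      fix y assume "y \<in> mball x r"
      then have y: "y \<in> D01" "sup_dist x y < r" by (auto simp: in_mball)
      have "\<bar>x (1 / 2) - y (1 / 2)\<bar> < r" using sup_dist_upper[OF x(1) y(1), of "1 / 2"] y(2) by auto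
      then show "y \<in> {x \<in> D01. cos (x (1 / 2)) \<in> U}"
        using r(2) y(1) by (auto simp: dist_real_def abs_minus_commute)
    qed
    then show "\<exists>r>0. mball x r \<subseteq> {x \<in> D01. cos (x (1 / 2)) \<in> U}" using r(1) by blast
  qed auto
  then show ?thesis by (simp add: continuous_map_def D01_topology_def)
qed

lemma wiener_cos_midpoint:
  assumes "wiener_measure \<mu>"
  shows "(\<integral>x. cos (x (1 / 2)) \<partial>\<mu>) = exp (- 1 / 4)"
proof -
  have bm: "std_brownian_motion \<mu> (\<lambda>t x. x t)" using assms by (simp add: wiener_measure_def)
  then have ps: "prob_space \<mu>"
    and ae: "AE x in \<mu>. x 0 = 0"
    and inc: "\<And>s t. 0 \<le> s \<Longrightarrow> s < t \<Longrightarrow> t \<le> 1 \<Longrightarrow> distributed \<mu> lborel (\<lambda>x. x t - x s) (normal_density 0 (sqrt (t - s)))"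
    by (auto simp: std_brownian_motion_def)
  have [measurable]: "(\<lambda>x. x (1 / 2) :: real) \<in> borel_measurable \<mu>" "(\<lambda>x. x 0 :: real) \<in> borel_measurable \<mu>"
    using bm by (auto simp: std_brownian_motion_def)
  have "(\<integral>x. cos (x (1 / 2)) \<partial>\<mu>) = (\<integral>x. cos (x (1 / 2) - x 0) \<partial>\<mu>)"
  proof (rule integral_cong_AE)
    show "AE x in \<mu>. cos (x (1 / 2)) = cos (x (1 / 2) - x 0)"
      using ae by eventually_elim simp
  qed measurable
  also have "\<dots> = exp (- (sqrt (1 / 2 - 0))\<^sup>2 / 2)"
    by (rule expectation_cos_normal[OF ps _ inc]) auto
  finally show ?thesis by simp
qed

text \<open>The midpoint of the normalized path of index \<open>2\<^sup>m\<^sup>+\<^sup>1\<close> is centred Gaussian, and its variance is the ratio in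
  question. The expectation of its cosine determines the variance, and converges by weak convergence.\<close>

lemma weak_limit_variance_ratio:
  assumes g: "\<And>n. centred_gaussian noise (v n) (partial_sum X n)" and pos: "\<And>n. 2 \<le> n \<Longrightarrow> 0 < v n"
    and \<mu>: "wiener_measure \<mu>" and conv: "converges_weakly D01_topology noise (normalized_path noise X) \<mu>"
  shows "(\<lambda>m. v (2 ^ m) / v (2 ^ Suc m)) \<longlonglongrightarrow> 1 / 2"
proof -
  have top: "topspace D01_topology = D01"
    unfolding D01_topology_def by (rule Metric_space.topspace_mtopology[OF Metric_space_D01])
  have "bounded ((\<lambda>x. cos (x (1 / 2) :: real)) ` topspace D01_topology)"
    by (auto simp: bounded_iff intro!: exI[of _ 1])
  from conv[unfolded converges_weakly_def, rule_format, OF continuous_map_cos_midpoint this]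
  have "(\<lambda>n. \<integral>\<omega>. cos (normalized_path noise X n \<omega> (1 / 2)) \<partial>noise) \<longlonglongrightarrow> exp (- 1 / 4)"
    unfolding wiener_cos_midpoint[OF \<mu>] .
  then have lim: "(\<lambda>m. \<integral>\<omega>. cos (normalized_path noise X (2 ^ Suc m) \<omega> (1 / 2)) \<partial>noise) \<longlonglongrightarrow> exp (- 1 / 4)"
    by (rule LIMSEQ_subseq_LIMSEQ[unfolded comp_def]) (auto simp: strict_mono_Suc_iff)
  have eq: "(\<integral>\<omega>. cos (normalized_path noise X (2 ^ Suc m) \<omega> (1 / 2)) \<partial>noise) = exp (- (v (2 ^ m) / v (2 ^ Suc m)) / 2)" for m
  proof -
    have "(2::nat) ^ 1 \<le> 2 ^ Suc m" by (intro power_increasing) auto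
    then have p: "0 < v (2 ^ Suc m)" by (intro pos) simp
    have "normalized_path noise X (2 ^ Suc m) \<omega> (1 / 2) = (1 / sqrt (v (2 ^ Suc m))) * partial_sum X (2 ^ m) \<omega>" for \<omega>
      unfolding normalized_path_def noise.P.centred_gaussian_variance[OF g] by (simp add: nat_power_eq)
    moreover have "centred_gaussian noise ((1 / sqrt (v (2 ^ Suc m)))\<^sup>2 * v (2 ^ m)) (\<lambda>\<omega>. (1 / sqrt (v (2 ^ Suc m))) * partial_sum X (2 ^ m) \<omega>)"
      by (rule noise.P.centred_gaussian_scale[OF g])
    ultimately show ?thesis
      using noise.P.centred_gaussian_cos p by (simp add: power_divide)
  qed
  have "(\<lambda>m. - 2 * ln (exp (- (v (2 ^ m) / v (2 ^ Suc m)) / 2))) \<longlonglongrightarrow> - 2 * ln (exp (- 1 / 4))"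
    by (rule tendsto_mult[OF tendsto_const tendsto_ln[OF lim[unfolded eq]]]) simp
  then show ?thesis by simp
qed

section \<open>The process and its filtration\<close>

theorem proposition10:
  shows "\<exists>(M :: (int \<Rightarrow> real) measure) (t :: nat \<Rightarrow> real)
            (Y :: int \<Rightarrow> (int \<Rightarrow> real) \<Rightarrow> real) (X :: int \<Rightarrow> (int \<Rightarrow> real) \<Rightarrow> real)
            (F :: int \<Rightarrow> (int \<Rightarrow> real) measure).
      prob_space M \<and>
      (\<forall>i. 0 \<le> t i) \<and>
      iid_std_normal M Y \<and>
      (\<forall>k. X k \<in> borel_measurable M) \<and>
      (\<forall>k. AE \<omega> in M. (\<lambda>i. t i * Y (k - int i) \<omega>) sums X k \<omega>) \<and>
      strictly_stationary M X \<and> gaussian_process M X \<and> positively_associated M X \<and>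
      (\<forall>k. subalgebra M (F k)) \<and> (\<forall>i j. i \<le> j \<longrightarrow> sets (F i) \<subseteq> sets (F j)) \<and>
      \<comment> \<open>(i)\<close>
      (\<forall>k. X k \<in> borel_measurable (F k)) \<and>
      \<comment> \<open>(ii)\<close>
      (\<forall>k. AE \<omega> in M. real_cond_exp M (filtration_tail M F) (X k) \<omega> = 0) \<and>
      \<comment> \<open>(iii)\<close>
      (SUP k\<in>{0::int..}. \<Sum>\<^sub>\<infinity>j\<in>(UNIV::int set). ennreal (L2_norm M (proj_diff M F j (X k)))) < \<infinity> \<and>
      \<comment> \<open>(iv)\<close>
      \<not> regularly_varying_1 (\<lambda>n. prob_space.variance M (partial_sum X n)) \<and>
      (\<exists>c>0. \<exists>\<kappa> :: nat \<Rightarrow> nat. strict_mono \<kappa> \<and>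
         (\<forall>n. 1 < \<kappa> n \<and>
              prob_space.variance M (partial_sum X (\<kappa> n)) \<ge>
                c * (real (\<kappa> n))\<^sup>2 / (ln (real (\<kappa> n))) ^ 4)) \<and>
      \<comment> \<open>(v)\<close>
      \<not> (\<exists>\<mu>. wiener_measure \<mu> \<and>
             converges_weakly D01_topology M (normalized_path M X) \<mu>)"
proof -
  define X where "X = linear_process log_coeff"
  note c = summable_log_coeff_square
  obtain a :: "nat \<Rightarrow> nat" where a: "strict_mono a" "\<And>l. (\<Sum>i. (log_coeff (i + a l))\<^sup>2) \<le> (1 / 4) ^ l"
    using sparse_tails[OF c] by blast
  define F where "F j = observed (window a j)" for j
  define v where "v = partial_sum_variance log_coeff"
  have g: "centred_gaussian noise (v n) (partial_sum X n)" for n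
    unfolding v_def X_def by (rule centred_gaussian_partial_sum[OF c log_coeff_nonneg log_coeff_antimono])
  have low: "1 / 243 * (real n)\<^sup>2 / ln (real n) ^ 4 \<le> v n" if "2 \<le> n" for n
    using log_coeff_lower_bound[OF that]
      partial_sum_variance_lower[OF c log_coeff_nonneg log_coeff_antimono, of n]
    unfolding v_def by simp
  have pos: "0 < v n" if "2 \<le> n" for n
    using that by (intro less_le_trans[OF _ low[OF that]] divide_pos_pos) auto
  have noratio: "\<not> (\<lambda>m. v (2 ^ m) / v (2 ^ Suc m)) \<longlonglongrightarrow> 1 / 2"
    by (rule dyadic_ratio_not_half[of "1 / 243"]) (use low in auto)
  have sums: "AE \<omega> in noise. (\<lambda>i. log_coeff i * \<omega> (k - int i)) sums X k \<omega>" for k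
    using AE_summable_linear_process[OF c, of k]
    by eventually_elim (simp add: X_def linear_process_def summable_sums)
  have iid: "iid_std_normal noise (\<lambda>i \<omega>. \<omega> i)"
    unfolding iid_std_normal_def using indep_vars_coordinates[of "\<lambda>i. i"] distributed_coordinate by simp
  have not_rv: "\<not> regularly_varying_1 v"
  proof
    assume "regularly_varying_1 v"
    then have "(\<lambda>n. v (nat \<lfloor>1 / 2 * real n\<rfloor>) / v n) \<longlonglongrightarrow> 1 / 2"
      unfolding regularly_varying_1_def by (rule allE[of _ "1 / 2"]) simp
    then have "(\<lambda>m. v (nat \<lfloor>1 / 2 * real (2 ^ Suc m)\<rfloor>) / v (2 ^ Suc m)) \<longlonglongrightarrow> 1 / 2"
      by (rule LIMSEQ_subseq_LIMSEQ[unfolded comp_def]) (auto simp: strict_mono_Suc_iff)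
    moreover have "nat \<lfloor>1 / 2 * real (2 ^ Suc m)\<rfloor> = 2 ^ m" for m
    proof -
      have "1 / 2 * real (2 ^ Suc m) = of_int (2 ^ m)" by simp
      then show ?thesis by (simp only: floor_of_int) (simp add: nat_power_eq)
    qed
    ultimately show False using noratio by (simp only:)
  qed
  have not_weak: "\<not> (\<exists>\<mu>. wiener_measure \<mu> \<and> converges_weakly D01_topology noise (normalized_path noise X) \<mu>)"
    using weak_limit_variance_ratio[OF g pos] noratio by blast
  \<comment> \<open>The lower bound holds for every \<open>n \<ge> 2\<close>, so all these indices can serve as the subsequence.\<close>
  have growth: "\<exists>c>0. \<exists>\<kappa> :: nat \<Rightarrow> nat. strict_mono \<kappa> \<and>
      (\<forall>n. 1 < \<kappa> n \<and> v (\<kappa> n) \<ge> c * (real (\<kappa> n))\<^sup>2 / (ln (real (\<kappa> n))) ^ 4)"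
  proof (intro exI[of _ "1 / 243"] exI[of _ "\<lambda>n. n + 2"] conjI allI)
    show "v (n + 2) \<ge> 1 / 243 * (real (n + 2))\<^sup>2 / ln (real (n + 2)) ^ 4" for n by (rule low) simp
  qed (auto simp: strict_mono_def)
  have X_meas: "X k \<in> borel_measurable (F k)" for k
    unfolding X_def F_def by (rule measurable_linear_process_observed) (simp add: past_in_window)
  have tail: "AE \<omega> in noise. real_cond_exp noise (filtration_tail noise F) (X k) \<omega> = 0" for k
    unfolding X_def F_def[abs_def] by (rule cond_exp_remote_past[OF c a(1)])
  have proj: "(SUP k\<in>{0::int..}. \<Sum>\<^sub>\<infinity>j\<in>(UNIV::int set). ennreal (L2_norm noise (proj_diff noise F j (X k)))) < \<infinity>"
    unfolding X_def F_def[abs_def] by (rule summable_projections[OF c a])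
  show ?thesis
    by (intro exI[of _ noise] exI[of _ log_coeff] exI[of _ "\<lambda>i \<omega>. \<omega> i"] exI[of _ X] exI[of _ F] conjI allI impI
        prob_space_noise log_coeff_nonneg iid sums tail proj X_meas not_weak
        not_rv[unfolded v_def, folded X_def] growth[unfolded v_def, folded X_def])
      (auto simp: X_def F_def subalgebra_observed sets_observed_mono window_mono stationary_linear_process
        gaussian_linear_process[OF c] positively_associated_linear_process[OF c log_coeff_nonneg])
qed

end
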